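(* Let $\varphi:R_1\to R$ be a homomorphism of commutative rings, $M$ an $R$-module, and $M_1$ an $R_1$-module. Then (i) if $\varphi$ is surjective, one has $(\operatorname{tr}_{R_1}M)R\subseteq\operatorname{tr}_R M$; (ii) $(\operatorname{tr}_{R_1}M_1)R\subseteq\operatorname{tr}_R(M_1\otimes_{R_1}R)$; (iii) if $\varphi$ is a flat morphism, $R_1$ is a Noetherian ring and $M_1$ is a finitely generated $R_1$-module, one has $(\operatorname{tr}_{R_1}M_1)R=\operatorname{tr}_R(M_1\otimes_{R_1}R)$.
   Context: For a module $N$ over a commutative ring $A$, the trace of $N$ is the ideal $\operatorname{tr}_A N=\sum_{f\in\operatorname{Hom}_A(N,A)}f(N)$ of $A$. In (i), $M$ is regarded as an $R_1$-module via $\varphi$. For an ideal $\mathfrak a\subseteq R_1$, $\mathfrak aR$ denotes the ideal of $R$ generated by $\varphi(\mathfrak a)$. *)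

theory Defs
  imports "HOL-Algebra.Algebra"
begin

text \<open>The library's record type of modules extends that of rings. Multiplication and one of such a
  record play no role for a module; they are left undefined in the modules constructed here.\<close>

definition ring_as_module :: "('a, 'p) ring_scheme \<Rightarrow> ('a, 'a) module" where
  "ring_as_module A =
     \<lparr>carrier = carrier A, monoid.mult = undefined, one = undefined,
      ring.zero = \<zero>\<^bsub>A\<^esub>, add = add A, smult = monoid.mult A\<rparr>"

definition restrict_scalars ::
    "('a \<Rightarrow> 'b) \<Rightarrow> ('b, 'm, 'x) module_scheme \<Rightarrow> ('a, 'm) module" where
  "restrict_scalars \<phi> M =
     \<lparr>carrier = carrier M, monoid.mult = undefined, one = undefined,
      ring.zero = \<zero>\<^bsub>M\<^esub>, add = add M, smult = (\<lambda>a m. \<phi> a \<odot>\<^bsub>M\<^esub> m)\<rparr>"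

definition mod_hom ::
    "('a, 'p) ring_scheme \<Rightarrow> ('a, 'm, 'x) module_scheme \<Rightarrow> ('a, 'n, 'y) module_scheme
       \<Rightarrow> ('m \<Rightarrow> 'n) set" where
  "mod_hom A M N =
     {f \<in> carrier M \<rightarrow> carrier N.
        (\<forall>x\<in>carrier M. \<forall>y\<in>carrier M. f (x \<oplus>\<^bsub>M\<^esub> y) = f x \<oplus>\<^bsub>N\<^esub> f y) \<and>
        (\<forall>a\<in>carrier A. \<forall>x\<in>carrier M. f (a \<odot>\<^bsub>M\<^esub> x) = a \<odot>\<^bsub>N\<^esub> f x)}"

text \<open>The sum of the ideals \<open>f(N)\<close>, as the set of finite sums of their elements. Linear maps that
  agree on \<open>carrier N\<close> may differ as functions; this only repeats summands of the sum of ideals.\<close>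

definition trace_ideal :: "('a, 'p) ring_scheme \<Rightarrow> ('a, 'm, 'x) module_scheme \<Rightarrow> 'a set" where
  "trace_ideal A N =
     {finsum A (\<lambda>f. f (x f)) F | F x.
        finite F \<and> F \<subseteq> mod_hom A N (ring_as_module A) \<and> x \<in> F \<rightarrow> carrier N}"

definition extended_ideal :: "('b, 'q) ring_scheme \<Rightarrow> ('a \<Rightarrow> 'b) \<Rightarrow> 'a set \<Rightarrow> 'b set" where
  "extended_ideal B \<phi> I = Idl\<^bsub>B\<^esub> (\<phi> ` I)"

definition finitely_generated_module ::
    "('a, 'p) ring_scheme \<Rightarrow> ('a, 'm, 'x) module_scheme \<Rightarrow> bool" where
  "finitely_generated_module A M \<longleftrightarrow>
     (\<exists>S \<subseteq> carrier M. finite S \<and>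
        carrier M = {finsum M (\<lambda>s. c s \<odot>\<^bsub>M\<^esub> s) S | c. c \<in> S \<rightarrow> carrier A})"

text \<open>The tensor product of two \<open>A\<close>-modules is the free abelian group on pairs modulo the subgroup
  generated by the bilinearity relations. Its elements are cosets of this subgroup.\<close>

definition tensor_relations ::
    "('a, 'p) ring_scheme \<Rightarrow> ('a, 'm, 'x) module_scheme \<Rightarrow> ('a, 'n, 'y) module_scheme
       \<Rightarrow> ('m \<times> 'n \<Rightarrow>\<^sub>0 int) set" where
  "tensor_relations A M N = generate (free_Abelian_group (carrier M \<times> carrier N))
     ({frag_of (m \<oplus>\<^bsub>M\<^esub> m', n) - frag_of (m, n) - frag_of (m', n) | m m' n.
         m \<in> carrier M \<and> m' \<in> carrier M \<and> n \<in> carrier N} \<union>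
      {frag_of (m, n \<oplus>\<^bsub>N\<^esub> n') - frag_of (m, n) - frag_of (m, n') | m n n'.
         m \<in> carrier M \<and> n \<in> carrier N \<and> n' \<in> carrier N} \<union>
      {frag_of (a \<odot>\<^bsub>M\<^esub> m, n) - frag_of (m, a \<odot>\<^bsub>N\<^esub> n) | a m n.
         a \<in> carrier A \<and> m \<in> carrier M \<and> n \<in> carrier N})"

definition tensor_group ::
    "('a, 'p) ring_scheme \<Rightarrow> ('a, 'm, 'x) module_scheme \<Rightarrow> ('a, 'n, 'y) module_scheme
       \<Rightarrow> ('m \<times> 'n \<Rightarrow>\<^sub>0 int) set monoid" where
  "tensor_group A M N =
     free_Abelian_group (carrier M \<times> carrier N) Mod tensor_relations A M N"

text \<open>The map \<open>f \<otimes> g\<close> into the tensor product of \<open>M'\<close> and \<open>N'\<close>. The image of a coset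
  \<open>x + H\<close> under the induced map of free abelian groups is only a subset of a coset of the
  relation subgroup \<open>H'\<close> of the target; adding \<open>H'\<close> to it gives that coset.\<close>

definition tensor_map ::
    "('a, 'p) ring_scheme \<Rightarrow> ('a, 'm2, 'x) module_scheme \<Rightarrow> ('a, 'n2, 'y) module_scheme
       \<Rightarrow> ('m \<Rightarrow> 'm2) \<Rightarrow> ('n \<Rightarrow> 'n2)
       \<Rightarrow> ('m \<times> 'n \<Rightarrow>\<^sub>0 int) set \<Rightarrow> ('m2 \<times> 'n2 \<Rightarrow>\<^sub>0 int) set" where
  "tensor_map A M' N' f g C =
     set_mult (free_Abelian_group (carrier M' \<times> carrier N')) (tensor_relations A M' N')
       (frag_extend (\<lambda>p. frag_of (map_prod f g p)) ` C)"

definition tensor_product ::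
    "('a, 'p) ring_scheme \<Rightarrow> ('a, 'm, 'x) module_scheme \<Rightarrow> ('a, 'n, 'y) module_scheme
       \<Rightarrow> ('a, ('m \<times> 'n \<Rightarrow>\<^sub>0 int) set) module" where
  "tensor_product A M N =
     \<lparr>carrier = carrier (tensor_group A M N), monoid.mult = undefined, one = undefined,
      ring.zero = \<one>\<^bsub>tensor_group A M N\<^esub>, add = monoid.mult (tensor_group A M N),
      smult = (\<lambda>a. tensor_map A M N id (\<lambda>n. a \<odot>\<^bsub>N\<^esub> n))\<rparr>"

text \<open>For a ring homomorphism \<open>\<phi>\<close> from \<open>A\<close> to \<open>B\<close>, the tensor product over \<open>A\<close> of \<open>M\<close> and \<open>B\<close>,
  with \<open>B\<close> acting through the second factor.\<close>

definition base_change ::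
    "('a, 'p) ring_scheme \<Rightarrow> ('b, 'q) ring_scheme \<Rightarrow> ('a \<Rightarrow> 'b) \<Rightarrow> ('a, 'm, 'x) module_scheme
       \<Rightarrow> ('b, ('m \<times> 'b \<Rightarrow>\<^sub>0 int) set) module" where
  "base_change A B \<phi> M =
     (let B' = restrict_scalars \<phi> (ring_as_module B); T = tensor_product A M B' in
      \<lparr>carrier = carrier T, monoid.mult = undefined, one = undefined,
       ring.zero = \<zero>\<^bsub>T\<^esub>, add = add T,
       smult = (\<lambda>b. tensor_map A M B' id (\<lambda>s. b \<otimes>\<^bsub>B\<^esub> s))\<rparr>)"

definition exact_at ::
    "('a, 'm, 'x) module_scheme \<Rightarrow> ('a, 'n, 'y) module_scheme \<Rightarrow> ('a, 'k, 'z) module_scheme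
       \<Rightarrow> ('m \<Rightarrow> 'n) \<Rightarrow> ('n \<Rightarrow> 'k) \<Rightarrow> bool" where
  "exact_at L M N f g \<longleftrightarrow> f ` carrier L = a_kernel M N g"

text \<open>\<open>N\<close> is flat if tensoring with \<open>N\<close> preserves exact sequences of \<open>A\<close>-modules. A formula of HOL
  cannot quantify over types, so the modules in the sequence have their elements in the fixed type
  \<open>(nat \<Rightarrow> 'a) set\<close>. It contains a copy of every countably generated \<open>A\<close>-module: a quotient of
  the module of finitely supported sequences, with cosets as elements. Hence the test includes the
  sequences from \<open>0\<close> through an ideal \<open>I\<close> to \<open>A\<close> with \<open>I\<close> finitely generated, and so, by the
  ideal criterion, it is equivalent to testing sequences of arbitrary modules.\<close>

definition flat_module :: "('a, 'p) ring_scheme \<Rightarrow> ('a, 'n, 'y) module_scheme \<Rightarrow> bool" where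
  "flat_module A N \<longleftrightarrow>
     module A N \<and>
     (\<forall>(L1 :: ('a, (nat \<Rightarrow> 'a) set) module) (L2 :: ('a, (nat \<Rightarrow> 'a) set) module)
        (L3 :: ('a, (nat \<Rightarrow> 'a) set) module).
        \<forall>f \<in> mod_hom A L1 L2. \<forall>g \<in> mod_hom A L2 L3.
          module A L1 \<and> module A L2 \<and> module A L3 \<and> exact_at L1 L2 L3 f g \<longrightarrow>
          exact_at (tensor_product A L1 N) (tensor_product A L2 N) (tensor_product A L3 N)
            (tensor_map A L2 N f id) (tensor_map A L3 N g id))"

definition flat_ring_hom ::
    "('a, 'p) ring_scheme \<Rightarrow> ('b, 'q) ring_scheme \<Rightarrow> ('a \<Rightarrow> 'b) \<Rightarrow> bool" where
  "flat_ring_hom A B \<phi> \<longleftrightarrow>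
     \<phi> \<in> ring_hom A B \<and> flat_module A (restrict_scalars \<phi> (ring_as_module B))"

end

theory Submission
  imports Defs
begin

text \<open>For surjective \<open>\<phi>\<close>, composing a linear map \<open>M \<rightarrow> R\<^sub>1\<close> with \<open>\<phi>\<close> gives an \<open>R\<close>-linear map. A map
  \<open>f : M\<^sub>1 \<rightarrow> R\<^sub>1\<close> induces \<open>m \<otimes> s \<mapsto> \<phi> (f m) s\<close> on the base change, with value \<open>\<phi> (f m)\<close> at
  \<open>m \<otimes> 1\<close>.

  For the converse, let \<open>\<mu>\<^sub>j\<close> generate \<open>M\<^sub>1\<close> and let \<open>g\<close> be \<open>R\<close>-linear on the base change. The
  elements \<open>y\<^sub>j = g (\<mu>\<^sub>j \<otimes> 1)\<close> satisfy the linear relations of the \<open>\<mu>\<^sub>j\<close>, which amount to a finite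
  linear system since \<open>R\<^sub>1\<close> is noetherian. By flatness \<open>y\<close> is an \<open>R\<close>-combination of solutions \<open>z\<close>
  over \<open>R\<^sub>1\<close>, and each \<open>z\<close> gives a linear map \<open>M\<^sub>1 \<rightarrow> R\<^sub>1\<close> with \<open>\<mu>\<^sub>j \<mapsto> z\<^sub>j\<close>. Hence every \<open>y\<^sub>j\<close> lies in
  the extended trace ideal, and the \<open>y\<^sub>j\<close> generate the image of \<open>g\<close>.\<close>

section \<open>Modules and trace ideals\<close>

lemma additive_imp_abelian_group_hom:
  assumes "abelian_group G" "abelian_group H"
    and "h \<in> carrier G \<rightarrow> carrier H"
    and "\<And>x y. x \<in> carrier G \<Longrightarrow> y \<in> carrier G \<Longrightarrow> h (x \<oplus>\<^bsub>G\<^esub> y) = h x \<oplus>\<^bsub>H\<^esub> h y"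
  shows "abelian_group_hom G H h"
  using assms
  by (intro abelian_group_homI group_hom.intro group_hom_axioms.intro)
    (auto simp: hom_def abelian_group.a_group)

context abelian_group_hom
begin

lemma hom_minus:
  assumes "x \<in> carrier G" "y \<in> carrier G"
  shows "h (x \<ominus>\<^bsub>G\<^esub> y) = h x \<ominus>\<^bsub>H\<^esub> h y"
  using assms by (simp add: a_minus_def)

lemma hom_finsum:
  assumes "f \<in> F \<rightarrow> carrier G"
  shows "h (finsum G f F) = finsum H (\<lambda>i. h (f i)) F"
  using assms
proof (induction F rule: infinite_finite_induct)
  case (insert i F)
  then have "f \<in> F \<rightarrow> carrier G" "f i \<in> carrier G" "(\<lambda>i. h (f i)) \<in> F \<rightarrow> carrier H"
    by (simp_all add: Pi_iff)
  with insert show ?case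
    by simp
qed auto

end

lemma (in additive_subgroup) finsum_mem:
  assumes "abelian_group G" "f \<in> F \<rightarrow> H"
  shows "finsum G f F \<in> H"
  using assms(2)
proof (induction F rule: infinite_finite_induct)
  case (insert i F)
  interpret abelian_group G by fact
  have "f i \<in> H" "f \<in> F \<rightarrow> H" "f i \<in> carrier G" "f \<in> F \<rightarrow> carrier G"
    using insert.prems a_subset by auto
  with insert show ?case
    by simp
qed (use assms(1) in \<open>auto simp: abelian_group_def abelian_monoid.finsum_infinite abelian_monoid.finsum_empty\<close>)

section \<open>The regular module and restriction of scalars\<close>

lemma ring_as_module_simps [simp]:
  "carrier (ring_as_module A) = carrier A"
  "add (ring_as_module A) = add A"
  "\<zero>\<^bsub>ring_as_module A\<^esub> = \<zero>\<^bsub>A\<^esub>"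
  "a \<odot>\<^bsub>ring_as_module A\<^esub> b = a \<otimes>\<^bsub>A\<^esub> b"
  by (simp_all add: ring_as_module_def)

lemma restrict_scalars_simps [simp]:
  "carrier (restrict_scalars \<phi> M) = carrier M"
  "add (restrict_scalars \<phi> M) = add M"
  "\<zero>\<^bsub>restrict_scalars \<phi> M\<^esub> = \<zero>\<^bsub>M\<^esub>"
  "a \<odot>\<^bsub>restrict_scalars \<phi> M\<^esub> x = \<phi> a \<odot>\<^bsub>M\<^esub> x"
  by (simp_all add: restrict_scalars_def)

text \<open>The module records built here leave their ring multiplication undefined, so the group
  axioms are transferred by comparing the additive fields alone.\<close>

lemma abelian_group_cong:
  assumes "abelian_group G" "carrier H = carrier G" "add H = add G" "\<zero>\<^bsub>H\<^esub> = \<zero>\<^bsub>G\<^esub>"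
  shows "abelian_group H"
proof -
  interpret G: abelian_group G by fact
  show ?thesis
    by (intro abelian_groupI) (auto simp: assms(2-) G.a_assoc intro: G.a_comm G.add.l_inv_ex)
qed

text \<open>Lets a sum in a ring regarded as a module over another ring be computed in the ring
  itself.\<close>

lemma finsum_cong_structure:
  assumes "carrier H = carrier G" "add H = add G" "\<zero>\<^bsub>H\<^esub> = \<zero>\<^bsub>G\<^esub>"
  shows "finsum H = finsum G"
  by (simp add: finsum_def finprod_def fun_eq_iff assms)

lemma module_ring_as_module:
  assumes "cring A"
  shows "module A (ring_as_module A)"
proof -
  interpret cring A by fact
  have "abelian_group (ring_as_module A)"
    by (rule abelian_group_cong[OF abelian_group_axioms]) auto
  then show ?thesis
    by (intro moduleI) (auto simp: assms l_distr r_distr m_assoc)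
qed

lemma module_restrict_scalars:
  assumes "cring A" "\<phi> \<in> ring_hom A B" "module B M"
  shows "module A (restrict_scalars \<phi> M)"
proof -
  interpret module B M by fact
  have "abelian_group (restrict_scalars \<phi> M)"
    by (rule abelian_group_cong[OF M.abelian_group_axioms]) auto
  then show ?thesis
    using assms(1) ring_hom_memE[OF assms(2)]
    by (intro moduleI) (auto simp: smult_l_distr smult_r_distr smult_assoc1)
qed

section \<open>Linear maps and trace ideals\<close>

lemma mod_homI:
  assumes "\<And>x. x \<in> carrier M \<Longrightarrow> f x \<in> carrier N"
    and "\<And>x y. x \<in> carrier M \<Longrightarrow> y \<in> carrier M \<Longrightarrow> f (x \<oplus>\<^bsub>M\<^esub> y) = f x \<oplus>\<^bsub>N\<^esub> f y"
    and "\<And>a x. a \<in> carrier A \<Longrightarrow> x \<in> carrier M \<Longrightarrow> f (a \<odot>\<^bsub>M\<^esub> x) = a \<odot>\<^bsub>N\<^esub> f x"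
  shows "f \<in> mod_hom A M N"
  using assms by (auto simp: mod_hom_def)

lemma mod_homD:
  assumes "f \<in> mod_hom A M N"
  shows "x \<in> carrier M \<Longrightarrow> f x \<in> carrier N"
    and "x \<in> carrier M \<Longrightarrow> y \<in> carrier M \<Longrightarrow> f (x \<oplus>\<^bsub>M\<^esub> y) = f x \<oplus>\<^bsub>N\<^esub> f y"
    and "a \<in> carrier A \<Longrightarrow> x \<in> carrier M \<Longrightarrow> f (a \<odot>\<^bsub>M\<^esub> x) = a \<odot>\<^bsub>N\<^esub> f x"
  using assms by (auto simp: mod_hom_def)

lemma id_mod_hom: "id \<in> mod_hom A M M"
  by (rule mod_homI) auto

lemma trace_ideal_memI:
  assumes "abelian_group A" "f \<in> mod_hom A N (ring_as_module A)" "x \<in> carrier N"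
  shows "f x \<in> trace_ideal A N"
proof -
  interpret abelian_group A by fact
  have "f x \<in> carrier A"
    using mod_homD(1)[OF assms(2,3)] by simp
  then show ?thesis
    unfolding trace_ideal_def mem_Collect_eq
    using assms(2,3) by (intro exI[of _ "{f}"] exI[of _ "\<lambda>_. x"]) simp
qed

text \<open>An ideal absorbs finite sums, so testing single values is enough. With
  \<open>trace_ideal_memI\<close> and \<open>ideal_trace_ideal\<close> this makes the trace the
  least ideal containing all values of linear forms.\<close>

lemma trace_ideal_subsetI:
  assumes "ideal I A"
    and "\<And>f x. f \<in> mod_hom A N (ring_as_module A) \<Longrightarrow> x \<in> carrier N \<Longrightarrow> f x \<in> I"
  shows "trace_ideal A N \<subseteq> I"
proof -
  interpret ideal I A by fact
  show ?thesis
    unfolding trace_ideal_def using assms(2) by (auto intro!: finsum_mem is_abelian_group)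
qed

text \<open>Scalars are absorbed into the arguments of the maps, and two sums are merged over the
  union of their index sets. Of \<open>N\<close> only closure is assumed, so the base change is
  covered without a proof of its module axioms.\<close>

lemma ideal_trace_ideal:
  assumes "cring A"
    and add: "\<And>x y. x \<in> carrier N \<Longrightarrow> y \<in> carrier N \<Longrightarrow> x \<oplus>\<^bsub>N\<^esub> y \<in> carrier N"
    and smult: "\<And>a x. a \<in> carrier A \<Longrightarrow> x \<in> carrier N \<Longrightarrow> a \<odot>\<^bsub>N\<^esub> x \<in> carrier N"
  shows "ideal (trace_ideal A N) A"
proof -
  interpret cring A by fact
  let ?Hom = "mod_hom A N (ring_as_module A)"
  have val: "f x \<in> carrier A" if "f \<in> ?Hom" "x \<in> carrier N" for f x
    using mod_homD(1)[OF that] by simp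
  have sub: "trace_ideal A N \<subseteq> carrier A"
    using oneideal val by (rule trace_ideal_subsetI)
  have sum: "s \<oplus>\<^bsub>A\<^esub> t \<in> trace_ideal A N" if st: "s \<in> trace_ideal A N" "t \<in> trace_ideal A N" for s t
  proof -
    from st obtain F x G y where
      F: "finite F" "F \<subseteq> ?Hom" "x \<in> F \<rightarrow> carrier N" "s = finsum A (\<lambda>f. f (x f)) F" and
      G: "finite G" "G \<subseteq> ?Hom" "y \<in> G \<rightarrow> carrier N" "t = finsum A (\<lambda>f. f (y f)) G"
      unfolding trace_ideal_def by blast
    \<comment> \<open>Each map indexes one summand only, so a map common to \<open>F\<close> and
      \<open>G\<close> must receive both arguments at once, as their sum.\<close>
    define w where "w f = (if f \<in> F \<inter> G then x f \<oplus>\<^bsub>N\<^esub> y f else if f \<in> F then x f else y f)" for f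
    have xF: "f (x f) \<in> carrier A" if "f \<in> F" for f using that F val by blast
    have yG: "f (y f) \<in> carrier A" if "f \<in> G" for f using that G val by blast
    \<comment> \<open>Padding with zeros brings both sums to the index set
      \<open>F \<union> G\<close>.\<close>
    have "s = finsum A (\<lambda>f. if f \<in> F then f (x f) else \<zero>\<^bsub>A\<^esub>) (F \<union> G)"
      unfolding F(4) using F(1) G(1) xF by (intro add.finprod_mono_neutral_cong_left) auto
    moreover have "t = finsum A (\<lambda>f. if f \<in> G then f (y f) else \<zero>\<^bsub>A\<^esub>) (F \<union> G)"
      unfolding G(4) using F(1) G(1) yG by (intro add.finprod_mono_neutral_cong_left) auto
    ultimately have "s \<oplus>\<^bsub>A\<^esub> t = finsum A (\<lambda>f. (if f \<in> F then f (x f) else \<zero>\<^bsub>A\<^esub>) \<oplus>\<^bsub>A\<^esub>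
        (if f \<in> G then f (y f) else \<zero>\<^bsub>A\<^esub>)) (F \<union> G)"
      using xF yG by (subst finsum_addf) auto
    also have "\<dots> = finsum A (\<lambda>f. f (w f)) (F \<union> G)"
    proof (rule finsum_cong')
      have "w f \<in> carrier N" if "f \<in> F \<union> G" for f
        using that F(3) G(3) by (auto simp: w_def Pi_def intro: add)
      then show "(\<lambda>f. f (w f)) \<in> F \<union> G \<rightarrow> carrier A"
        using F(2) G(2) val by blast
      fix f assume f: "f \<in> F \<union> G"
      then have "f \<in> ?Hom"
        using F(2) G(2) by blast
      from mod_homD(2)[OF this, of "x f" "y f"] f F(3) G(3) xF[of f] yG[of f]
      show "(if f \<in> F then f (x f) else \<zero>\<^bsub>A\<^esub>) \<oplus>\<^bsub>A\<^esub> (if f \<in> G then f (y f) else \<zero>\<^bsub>A\<^esub>) = f (w f)"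
        by (auto simp: w_def Pi_def)
    qed simp
    finally have eq: "s \<oplus>\<^bsub>A\<^esub> t = finsum A (\<lambda>f. f (w f)) (F \<union> G)" .
    have "w \<in> F \<union> G \<rightarrow> carrier N"
      using F(3) G(3) by (auto simp: w_def Pi_def intro: add)
    with eq F(1,2) G(1,2) show ?thesis
      unfolding trace_ideal_def mem_Collect_eq
      by (intro exI[of _ "F \<union> G"] exI[of _ w]) simp
  qed
  have mult: "a \<otimes>\<^bsub>A\<^esub> s \<in> trace_ideal A N" if a: "a \<in> carrier A" and s: "s \<in> trace_ideal A N" for a s
  proof -
    from s obtain F x where
      F: "finite F" "F \<subseteq> ?Hom" "x \<in> F \<rightarrow> carrier N" "s = finsum A (\<lambda>f. f (x f)) F"
      unfolding trace_ideal_def by blast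
    have xF: "f (x f) \<in> carrier A" if "f \<in> F" for f using that F val by blast
    have "a \<otimes>\<^bsub>A\<^esub> s = finsum A (\<lambda>f. a \<otimes>\<^bsub>A\<^esub> f (x f)) F"
      unfolding F(4) using F(1) a xF by (intro finsum_rdistr) auto
    also have "\<dots> = finsum A (\<lambda>f. f (a \<odot>\<^bsub>N\<^esub> x f)) F"
    proof (rule finsum_cong')
      have eq: "f (a \<odot>\<^bsub>N\<^esub> x f) = a \<otimes>\<^bsub>A\<^esub> f (x f)" if "f \<in> F" for f
        using that F(2,3) mod_homD(3)[of f A N "ring_as_module A" a "x f"] a by auto
      then show "(\<lambda>f. f (a \<odot>\<^bsub>N\<^esub> x f)) \<in> F \<rightarrow> carrier A"
        using xF a by (intro Pi_I) (metis m_closed)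
      show "a \<otimes>\<^bsub>A\<^esub> f (x f) = f (a \<odot>\<^bsub>N\<^esub> x f)" if "f \<in> F" for f
        using eq[OF that] ..
    qed simp
    finally show ?thesis
      unfolding trace_ideal_def mem_Collect_eq
      using F a smult by (intro exI[of _ F] exI[of _ "\<lambda>f. a \<odot>\<^bsub>N\<^esub> x f"]) auto
  qed
  have zero: "\<zero>\<^bsub>A\<^esub> \<in> trace_ideal A N"
    unfolding trace_ideal_def by (auto intro!: exI[of _ "{}"])
  show ?thesis
  proof (rule idealI)
    show "subgroup (trace_ideal A N) (add_monoid A)"
    proof (rule add.subgroupI)
      fix s assume s: "s \<in> trace_ideal A N"
      then have "\<ominus>\<^bsub>A\<^esub> s = (\<ominus>\<^bsub>A\<^esub> \<one>\<^bsub>A\<^esub>) \<otimes>\<^bsub>A\<^esub> s"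
        using sub by (auto simp: l_minus)
      then show "\<ominus>\<^bsub>A\<^esub> s \<in> trace_ideal A N"
        using s by (simp add: mult)
    qed (use sub zero sum in auto)
    show "s \<otimes>\<^bsub>A\<^esub> a \<in> trace_ideal A N" if "s \<in> trace_ideal A N" "a \<in> carrier A" for s a
      using mult[OF that(2,1)] that sub by (simp add: m_comm subset_iff)
  qed (use mult ring_axioms in auto)
qed

text \<open>Since \<open>\<phi>\<close> is additive, it carries a sum of values to a sum of images,
  and an ideal containing a set contains the ideal generated by it. Containment can therefore be
  tested on single values.\<close>

lemma extended_trace_ideal_subsetI:
  assumes "cring A" "cring B" "\<phi> \<in> ring_hom A B" "ideal I B"
    and "\<And>f x. f \<in> mod_hom A N (ring_as_module A) \<Longrightarrow> x \<in> carrier N \<Longrightarrow> \<phi> (f x) \<in> I"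
  shows "extended_ideal B \<phi> (trace_ideal A N) \<subseteq> I"
proof -
  interpret I: ideal I B by fact
  interpret \<phi>: ring_hom_cring A B \<phi>
    using assms by (intro ring_hom_cringI) auto
  have "\<phi> ` trace_ideal A N \<subseteq> I"
  proof clarify
    fix s assume "s \<in> trace_ideal A N"
    then obtain F x where
      F: "F \<subseteq> mod_hom A N (ring_as_module A)" "x \<in> F \<rightarrow> carrier N"
        "s = finsum A (\<lambda>f. f (x f)) F"
      unfolding trace_ideal_def by blast
    have "f (x f) \<in> carrier A" if "f \<in> F" for f
      using that F mod_homD(1)[of f A N "ring_as_module A" "x f"] by auto
    then have "\<phi> s = finsum B (\<lambda>f. \<phi> (f (x f))) F"
      unfolding F(3) using \<phi>.hom_finsum[of "\<lambda>f. f (x f)" F] by (auto simp: comp_def)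
    then show "\<phi> s \<in> I"
      using F assms(5) by (auto intro!: I.finsum_mem I.is_abelian_group)
  qed
  then show ?thesis
    unfolding extended_ideal_def using assms(4) by (rule I.genideal_minimal[rotated])
qed

section \<open>Traces along a surjection\<close>

lemma extended_trace_subset_trace_of_surj:
  assumes "cring A" "\<phi> \<in> ring_hom A B" "module B M" "\<phi> ` carrier A = carrier B"
  shows "extended_ideal B \<phi> (trace_ideal A (restrict_scalars \<phi> M)) \<subseteq> trace_ideal B M"
proof -
  interpret module B M by fact
  note hom = ring_hom_memE[OF assms(2)]
  show ?thesis
  proof (rule extended_trace_ideal_subsetI[OF assms(1) R.is_cring assms(2)])
    show "ideal (trace_ideal B M) B"
      by (intro ideal_trace_ideal R.is_cring) auto
    fix f x
    assume f: "f \<in> mod_hom A (restrict_scalars \<phi> M) (ring_as_module A)"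
      and x: "x \<in> carrier (restrict_scalars \<phi> M)"
    have "\<phi> \<circ> f \<in> mod_hom B M (ring_as_module B)"
    proof (rule mod_homI)
      \<comment> \<open>Surjectivity enters here: a scalar of \<open>B\<close> is the image of one
        of \<open>A\<close>, over which \<open>f\<close> is already linear.\<close>
      fix b m assume "b \<in> carrier B" and m: "m \<in> carrier M"
      then obtain a where a: "a \<in> carrier A" "b = \<phi> a"
        using assms(4) by auto
      then show "(\<phi> \<circ> f) (b \<odot>\<^bsub>M\<^esub> m) = b \<odot>\<^bsub>ring_as_module B\<^esub> (\<phi> \<circ> f) m"
        using mod_homD[OF f] m by (auto simp: hom)
    qed (use mod_homD[OF f] in \<open>auto simp: hom\<close>)
    from trace_ideal_memI[OF R.is_abelian_group this] x show "\<phi> (f x) \<in> trace_ideal B M"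
      by simp
  qed
qed

section \<open>The universal property of the tensor product\<close>

text \<open>The target is only an abelian group, so the last clause expresses balancedness; the
  three equations mirror the three families in \<open>tensor_relations\<close>.\<close>

definition bilinear_map ::
    "('a, 'p) ring_scheme \<Rightarrow> ('a, 'm, 'x) module_scheme \<Rightarrow> ('a, 'n, 'y) module_scheme
       \<Rightarrow> ('l, 'z) ring_scheme \<Rightarrow> ('m \<Rightarrow> 'n \<Rightarrow> 'l) \<Rightarrow> bool" where
  "bilinear_map A M N L \<beta> \<longleftrightarrow>
     \<beta> \<in> carrier M \<rightarrow> carrier N \<rightarrow> carrier L \<and>
     (\<forall>m\<in>carrier M. \<forall>m'\<in>carrier M. \<forall>n\<in>carrier N. \<beta> (m \<oplus>\<^bsub>M\<^esub> m') n = \<beta> m n \<oplus>\<^bsub>L\<^esub> \<beta> m' n) \<and>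
     (\<forall>m\<in>carrier M. \<forall>n\<in>carrier N. \<forall>n'\<in>carrier N. \<beta> m (n \<oplus>\<^bsub>N\<^esub> n') = \<beta> m n \<oplus>\<^bsub>L\<^esub> \<beta> m n') \<and>
     (\<forall>a\<in>carrier A. \<forall>m\<in>carrier M. \<forall>n\<in>carrier N. \<beta> (a \<odot>\<^bsub>M\<^esub> m) n = \<beta> m (a \<odot>\<^bsub>N\<^esub> n))"

lemma bilinear_mapI:
  assumes "\<And>m n. m \<in> carrier M \<Longrightarrow> n \<in> carrier N \<Longrightarrow> \<beta> m n \<in> carrier L"
    and "\<And>m m' n. m \<in> carrier M \<Longrightarrow> m' \<in> carrier M \<Longrightarrow> n \<in> carrier N \<Longrightarrow>
           \<beta> (m \<oplus>\<^bsub>M\<^esub> m') n = \<beta> m n \<oplus>\<^bsub>L\<^esub> \<beta> m' n"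
    and "\<And>m n n'. m \<in> carrier M \<Longrightarrow> n \<in> carrier N \<Longrightarrow> n' \<in> carrier N \<Longrightarrow>
           \<beta> m (n \<oplus>\<^bsub>N\<^esub> n') = \<beta> m n \<oplus>\<^bsub>L\<^esub> \<beta> m n'"
    and "\<And>a m n. a \<in> carrier A \<Longrightarrow> m \<in> carrier M \<Longrightarrow> n \<in> carrier N \<Longrightarrow>
           \<beta> (a \<odot>\<^bsub>M\<^esub> m) n = \<beta> m (a \<odot>\<^bsub>N\<^esub> n)"
  shows "bilinear_map A M N L \<beta>"
  using assms by (simp add: bilinear_map_def Pi_iff)

lemma bilinear_mapD:
  assumes "bilinear_map A M N L \<beta>"
  shows "m \<in> carrier M \<Longrightarrow> n \<in> carrier N \<Longrightarrow> \<beta> m n \<in> carrier L"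
    and "m \<in> carrier M \<Longrightarrow> m' \<in> carrier M \<Longrightarrow> n \<in> carrier N \<Longrightarrow>
           \<beta> (m \<oplus>\<^bsub>M\<^esub> m') n = \<beta> m n \<oplus>\<^bsub>L\<^esub> \<beta> m' n"
    and "m \<in> carrier M \<Longrightarrow> n \<in> carrier N \<Longrightarrow> n' \<in> carrier N \<Longrightarrow>
           \<beta> m (n \<oplus>\<^bsub>N\<^esub> n') = \<beta> m n \<oplus>\<^bsub>L\<^esub> \<beta> m n'"
    and "a \<in> carrier A \<Longrightarrow> m \<in> carrier M \<Longrightarrow> n \<in> carrier N \<Longrightarrow>
           \<beta> (a \<odot>\<^bsub>M\<^esub> m) n = \<beta> m (a \<odot>\<^bsub>N\<^esub> n)"
  using assms by (simp_all add: bilinear_map_def Pi_iff)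

definition tensor_class ::
    "('a, 'p) ring_scheme \<Rightarrow> ('a, 'm, 'x) module_scheme \<Rightarrow> ('a, 'n, 'y) module_scheme
       \<Rightarrow> ('m \<times> 'n \<Rightarrow>\<^sub>0 int) \<Rightarrow> ('m \<times> 'n \<Rightarrow>\<^sub>0 int) set" where
  "tensor_class A M N c =
     tensor_relations A M N #>\<^bsub>free_Abelian_group (carrier M \<times> carrier N)\<^esub> c"

definition pure_tensor ::
    "('a, 'p) ring_scheme \<Rightarrow> ('a, 'm, 'x) module_scheme \<Rightarrow> ('a, 'n, 'y) module_scheme
       \<Rightarrow> 'm \<Rightarrow> 'n \<Rightarrow> ('m \<times> 'n \<Rightarrow>\<^sub>0 int) set" where
  "pure_tensor A M N m n = tensor_class A M N (frag_of (m, n))"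

locale tensor_modules = M: module A M + N: module A N
  for A :: "('a, 'p) ring_scheme" (structure)
    and M :: "('a, 'm, 'x) module_scheme" and N :: "('a, 'n, 'y) module_scheme"
begin

abbreviation "G \<equiv> free_Abelian_group (carrier M \<times> carrier N)"
abbreviation "H \<equiv> tensor_relations A M N"
abbreviation "T \<equiv> tensor_product A M N"
abbreviation "cls \<equiv> tensor_class A M N"
abbreviation "pure \<equiv> pure_tensor A M N"

text \<open>The generating set inside \<open>tensor_relations\<close>, named so that membership and
  inclusion arguments can refer to it.\<close>

definition relators :: "('m \<times> 'n \<Rightarrow>\<^sub>0 int) set" where
  "relators =
     {frag_of (m \<oplus>\<^bsub>M\<^esub> m', n) - frag_of (m, n) - frag_of (m', n) | m m' n.
         m \<in> carrier M \<and> m' \<in> carrier M \<and> n \<in> carrier N} \<union>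
      {frag_of (m, n \<oplus>\<^bsub>N\<^esub> n') - frag_of (m, n) - frag_of (m, n') | m n n'.
         m \<in> carrier M \<and> n \<in> carrier N \<and> n' \<in> carrier N} \<union>
      {frag_of (a \<odot>\<^bsub>M\<^esub> m, n) - frag_of (m, a \<odot>\<^bsub>N\<^esub> n) | a m n.
         a \<in> carrier A \<and> m \<in> carrier M \<and> n \<in> carrier N}"

lemma relations_eq: "H = generate G relators"
  by (simp add: tensor_relations_def relators_def)

lemma relators_subset: "relators \<subseteq> carrier G"
  unfolding relators_def
  by (auto dest!: subsetD[OF keys_diff] split: if_splits)

lemma subgroup_relations: "subgroup H G"
  unfolding relations_eq
  by (intro group.generate_is_subgroup relators_subset group_free_Abelian_group)

lemma relations_subset: "c \<in> H \<Longrightarrow> c \<in> carrier G"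
  using subgroup.subset[OF subgroup_relations] by blast

lemma normal_relations: "H \<lhd> G"
  by (rule comm_group.normal_iff_subgroup[THEN iffD2, OF abelian_free_Abelian_group subgroup_relations])

lemma carrier_tensor: "carrier T = cls ` carrier G"
  unfolding tensor_product_def tensor_group_def tensor_class_def
  by (simp only: carrier_FactGroup partial_object.simps)

lemma abelian_group_tensor: "abelian_group T"
proof -
  interpret Q: comm_group "G Mod H"
    by (rule comm_group.abelian_FactGroup[OF abelian_free_Abelian_group subgroup_relations])
  have "carrier T = carrier (G Mod H)" "add T = monoid.mult (G Mod H)" "\<zero>\<^bsub>T\<^esub> = \<one>\<^bsub>G Mod H\<^esub>"
    by (simp_all add: tensor_product_def tensor_group_def)
  then show ?thesis
    by (intro abelian_groupI) (simp_all add: Q.m_ac Q.l_inv_ex del: mult_FactGroup one_FactGroup)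
qed

sublocale T: abelian_group T
  by (rule abelian_group_tensor)

lemma class_add:
  assumes "c \<in> carrier G" "d \<in> carrier G"
  shows "cls (c + d) = cls c \<oplus>\<^bsub>T\<^esub> cls d"
  using normal.rcos_sum[OF normal_relations assms]
  by (simp add: tensor_class_def tensor_product_def tensor_group_def)

lemma class_closed: "c \<in> carrier G \<Longrightarrow> cls c \<in> carrier T"
  by (simp add: carrier_tensor)

lemma class_relations:
  assumes "c \<in> H"
  shows "cls c = \<zero>\<^bsub>T\<^esub>"
  unfolding tensor_class_def tensor_product_def tensor_group_def ring.simps one_FactGroup
  using assms
  by (intro group.coset_join2 group_free_Abelian_group subgroup_relations relations_subset)

lemma class_diff:
  assumes "c \<in> carrier G" "d \<in> carrier G"
  shows "cls (c - d) = cls c \<ominus>\<^bsub>T\<^esub> cls d"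
proof -
  have cd: "c - d \<in> carrier G"
    using assms keys_diff[of c d] by auto
  have "cls c = cls (c - d) \<oplus>\<^bsub>T\<^esub> cls d"
    using class_add[OF cd assms(2)] by simp
  then show ?thesis
    using class_closed[OF cd] class_closed[OF assms(2)]
    by (simp add: a_minus_def T.a_assoc T.r_neg)
qed

lemma relator_mem:
  assumes "c \<in> relators" shows "c \<in> H"
  unfolding relations_eq using assms by (rule generate.incl)

lemma class_eqI:
  assumes "c \<in> carrier G" "d \<in> carrier G" "c - d \<in> H"
  shows "cls c = cls d"
proof -
  have "cls c = cls (c - d) \<oplus>\<^bsub>T\<^esub> cls d"
    using class_add[OF relations_subset[OF assms(3)] assms(2)] by simp
  then show ?thesis
    using class_relations[OF assms(3)] class_closed[OF assms(2)] by simp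
qed

text \<open>In each equation the representatives of the two sides differ by a relator.\<close>

lemma bilinear_pure: "bilinear_map A M N T pure"
proof (rule bilinear_mapI)
  show "pure m n \<in> carrier T" if "m \<in> carrier M" "n \<in> carrier N" for m n
    using that by (simp add: pure_tensor_def class_closed)
next
  fix m m' n assume m: "m \<in> carrier M" "m' \<in> carrier M" "n \<in> carrier N"
  have "cls (frag_of (m \<oplus>\<^bsub>M\<^esub> m', n)) = cls (frag_of (m, n) + frag_of (m', n))"
  proof (rule class_eqI)
    have "frag_of (m \<oplus>\<^bsub>M\<^esub> m', n) - frag_of (m, n) - frag_of (m', n) \<in> H"
      using m by (intro relator_mem) (auto simp: relators_def)
    then show "frag_of (m \<oplus>\<^bsub>M\<^esub> m', n) - (frag_of (m, n) + frag_of (m', n)) \<in> H"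
      by (simp add: diff_diff_eq)
  qed (use m in \<open>auto dest!: subsetD[OF keys_add] split: if_splits\<close>)
  with m show "pure (m \<oplus>\<^bsub>M\<^esub> m') n = pure m n \<oplus>\<^bsub>T\<^esub> pure m' n"
    by (simp add: pure_tensor_def class_add)
next
  fix m n n' assume m: "m \<in> carrier M" "n \<in> carrier N" "n' \<in> carrier N"
  have "cls (frag_of (m, n \<oplus>\<^bsub>N\<^esub> n')) = cls (frag_of (m, n) + frag_of (m, n'))"
  proof (rule class_eqI)
    have "frag_of (m, n \<oplus>\<^bsub>N\<^esub> n') - frag_of (m, n) - frag_of (m, n') \<in> H"
      using m by (intro relator_mem) (auto simp: relators_def)
    then show "frag_of (m, n \<oplus>\<^bsub>N\<^esub> n') - (frag_of (m, n) + frag_of (m, n')) \<in> H"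
      by (simp add: diff_diff_eq)
  qed (use m in \<open>auto dest!: subsetD[OF keys_add] split: if_splits\<close>)
  with m show "pure m (n \<oplus>\<^bsub>N\<^esub> n') = pure m n \<oplus>\<^bsub>T\<^esub> pure m n'"
    by (simp add: pure_tensor_def class_add)
next
  fix a m n assume m: "a \<in> carrier A" "m \<in> carrier M" "n \<in> carrier N"
  then have "frag_of (a \<odot>\<^bsub>M\<^esub> m, n) - frag_of (m, a \<odot>\<^bsub>N\<^esub> n) \<in> H"
    by (intro relator_mem) (auto simp: relators_def)
  with m show "pure (a \<odot>\<^bsub>M\<^esub> m) n = pure m (a \<odot>\<^bsub>N\<^esub> n)"
    unfolding pure_tensor_def by (intro class_eqI) auto
qed

lemmas pure_closed = bilinear_mapD(1)[OF bilinear_pure]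
  and pure_add_left = bilinear_mapD(2)[OF bilinear_pure]
  and pure_add_right = bilinear_mapD(3)[OF bilinear_pure]
  and pure_smult = bilinear_mapD(4)[OF bilinear_pure]

text \<open>Every class comes from an integer combination of pairs. Closure under subtraction yields
  all integer coefficients, so pure tensors generate the tensor product as a group and no case for
  scalars arises.\<close>

lemma tensor_induct [consumes 1, case_names zero pure diff]:
  assumes "x \<in> carrier T"
    and "P \<zero>\<^bsub>T\<^esub>"
    and "\<And>m n. m \<in> carrier M \<Longrightarrow> n \<in> carrier N \<Longrightarrow> P (pure m n)"
    and "\<And>x y. x \<in> carrier T \<Longrightarrow> y \<in> carrier T \<Longrightarrow> P x \<Longrightarrow> P y \<Longrightarrow> P (x \<ominus>\<^bsub>T\<^esub> y)"
  shows "P x"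
proof -
  obtain c where c: "c \<in> carrier G" "x = cls c"
    using assms(1) unfolding carrier_tensor by blast
  have "P (cls c)"
  proof (rule free_Abelian_group_induct[where P = "\<lambda>c. P (cls c)"])
    show "Poly_Mapping.keys c \<subseteq> carrier M \<times> carrier N"
      using c(1) by simp
    have "cls 0 = \<zero>\<^bsub>T\<^esub>"
      using subgroup.one_closed[OF subgroup_relations] by (intro class_relations) simp
    then show "P (cls 0)"
      using assms(2) by simp
  next
    fix c d
    assume "Poly_Mapping.keys c \<subseteq> carrier M \<times> carrier N" "Poly_Mapping.keys d \<subseteq> carrier M \<times> carrier N"
      and "P (cls c)" "P (cls d)"
    then show "P (cls (c - d))"
      using class_diff[of c d] class_closed[of c] class_closed[of d] assms(4) by simp
  next
    fix p assume "p \<in> carrier M \<times> carrier N"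
    then show "P (cls (frag_of p))"
      using assms(3) by (auto simp: pure_tensor_def)
  qed
  with c(2) show ?thesis by simp
qed

text \<open>Bilinearity puts every relator into the kernel of \<open>h\<close>, and a kernel is a
  subgroup. Formulated before passing to the quotient, this serves both the universal property and
  the tensor product of two linear maps.\<close>

lemma additive_vanishes_on_relations:
  assumes "abelian_group L" "h \<in> hom G (add_monoid L)" "bilinear_map A M N L \<beta>"
    and "\<And>m n. m \<in> carrier M \<Longrightarrow> n \<in> carrier N \<Longrightarrow> h (frag_of (m, n)) = \<beta> m n"
    and "c \<in> H"
  shows "h c = \<zero>\<^bsub>L\<^esub>"
proof -
  interpret L: abelian_group L by fact
  interpret h: group_hom G "add_monoid L" h
    using assms(2) by (intro group_hom.intro group_hom_axioms.intro L.a_group) auto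
  have diff: "h (c - d) = h c \<ominus>\<^bsub>L\<^esub> h d" if "c \<in> carrier G" "d \<in> carrier G" for c d
  proof -
    have "h (c \<otimes>\<^bsub>G\<^esub> inv\<^bsub>G\<^esub> d) = h c \<oplus>\<^bsub>L\<^esub> (\<ominus>\<^bsub>L\<^esub> h d)"
      using that by (simp only: h.hom_mult h.G.inv_closed h.hom_inv monoid.simps a_inv_def)
    then show ?thesis
      using that by (simp add: a_minus_def)
  qed
  have gen: "frag_of (m, n) \<in> carrier G" if "m \<in> carrier M" "n \<in> carrier N" for m n
    using that by simp
  have dcl: "c - d \<in> carrier G" if "c \<in> carrier G" "d \<in> carrier G" for c d
    using that keys_diff[of c d] by auto
  \<comment> \<open>The shape of the first two kinds of relator after applying \<open>h\<close>; the
    third kind becomes \<open>u \<ominus> u\<close>.\<close>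
  have cancel: "(u \<oplus>\<^bsub>L\<^esub> v) \<ominus>\<^bsub>L\<^esub> u \<ominus>\<^bsub>L\<^esub> v = \<zero>\<^bsub>L\<^esub>"
    if "u \<in> carrier L" "v \<in> carrier L" for u v
  proof -
    have "(u \<oplus>\<^bsub>L\<^esub> v) \<ominus>\<^bsub>L\<^esub> u \<ominus>\<^bsub>L\<^esub> v = (u \<oplus>\<^bsub>L\<^esub> v) \<oplus>\<^bsub>L\<^esub> \<ominus>\<^bsub>L\<^esub> (u \<oplus>\<^bsub>L\<^esub> v)"
      using that by (simp add: a_minus_def L.minus_add L.a_assoc)
    also have "\<dots> = \<zero>\<^bsub>L\<^esub>"
      using that by (intro L.r_neg) simp
    finally show "(u \<oplus>\<^bsub>L\<^esub> v) \<ominus>\<^bsub>L\<^esub> u \<ominus>\<^bsub>L\<^esub> v = \<zero>\<^bsub>L\<^esub>" .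
  qed
  note \<beta> = bilinear_mapD[OF assms(3)]
  have "relators \<subseteq> kernel G (add_monoid L) h"
    unfolding relators_def kernel_def
    by (auto simp: diff gen dcl assms(4) \<beta> cancel a_minus_def[of L u u for u] L.r_neg simp del: carrier_free_Abelian_group_iff)
  then have "H \<subseteq> kernel G (add_monoid L) h"
    unfolding relations_eq
    by (intro group.generate_subgroup_incl h.subgroup_kernel group_free_Abelian_group)
  then show ?thesis
    using assms(5) by (auto simp: kernel_def)
qed

text \<open>The bilinear map extends from pairs to the free abelian group, and the extension factors
  through the quotient because it kills the relations.\<close>

lemma tensor_universal:
  assumes "abelian_group L" "bilinear_map A M N L \<beta>"
  obtains h where "abelian_group_hom T L h"
    and "\<And>m n. m \<in> carrier M \<Longrightarrow> n \<in> carrier N \<Longrightarrow> h (pure m n) = \<beta> m n"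
proof -
  interpret L: abelian_group L by fact
  have "case_prod \<beta> ` (carrier M \<times> carrier N) \<subseteq> carrier (add_monoid L)"
    using bilinear_mapD(1)[OF assms(2)] by auto
  then obtain k where k: "k \<in> hom G (add_monoid L)"
    "\<And>p. p \<in> carrier M \<times> carrier N \<Longrightarrow> k (frag_of p) = case_prod \<beta> p"
    using comm_group.free_Abelian_group_universal[OF L.a_comm_group] by metis
  interpret k: group_hom G "add_monoid L" k
    using k(1) by (intro group_hom.intro group_hom_axioms.intro L.a_group) auto
  have "H \<subseteq> kernel G (add_monoid L) k"
    using additive_vanishes_on_relations[OF assms(1) k(1) assms(2)] k(2)
      relations_subset
    by (auto simp: kernel_def simp del: carrier_free_Abelian_group_iff)
  with normal_relations obtain h where h: "h \<in> hom (G Mod H) (add_monoid L)"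
    "\<And>c. c \<in> carrier G \<Longrightarrow> h (H #>\<^bsub>G\<^esub> c) = k c"
    by (rule k.FactGroup_universal_kernel) blast
  have "abelian_group_hom T L h"
    using h(1) by (intro additive_imp_abelian_group_hom abelian_group_tensor assms(1))
      (auto simp: hom_def tensor_product_def tensor_group_def)
  moreover have "h (pure m n) = \<beta> m n" if "m \<in> carrier M" "n \<in> carrier N" for m n
    using that h(2)[of "frag_of (m, n)"] k(2)[of "(m, n)"]
    by (simp add: pure_tensor_def tensor_class_def)
  ultimately show ?thesis
    by (rule that)
qed

lemma pure_finsum_left:
  assumes "f \<in> F \<rightarrow> carrier M" "n \<in> carrier N"
  shows "pure (finsum M f F) n = finsum T (\<lambda>i. pure (f i) n) F"
proof -
  interpret abelian_group_hom M T "\<lambda>m. pure m n"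
    using assms(2)
    by (intro additive_imp_abelian_group_hom M.M.abelian_group_axioms T.abelian_group_axioms)
      (auto simp: pure_closed pure_add_left)
  show ?thesis
    using assms(1) by (rule hom_finsum)
qed

lemma pure_finsum_right:
  assumes "f \<in> F \<rightarrow> carrier N" "m \<in> carrier M"
  shows "pure m (finsum N f F) = finsum T (\<lambda>i. pure m (f i)) F"
proof -
  interpret abelian_group_hom N T "pure m"
    using assms(2)
    by (intro additive_imp_abelian_group_hom N.M.abelian_group_axioms T.abelian_group_axioms)
      (auto simp: pure_closed pure_add_right)
  show ?thesis
    using assms(1) by (rule hom_finsum)
qed

lemma pure_zero_left: "n \<in> carrier N \<Longrightarrow> pure \<zero>\<^bsub>M\<^esub> n = \<zero>\<^bsub>T\<^esub>"
  \<comment> \<open>The zero of \<open>M\<close> is written as an empty sum, which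
    \<open>pure\<close> carries to an empty sum.\<close>
  using pure_finsum_left[of "\<lambda>_. undefined" "{}" n] by simp

lemma pure_zero_right: "m \<in> carrier M \<Longrightarrow> pure m \<zero>\<^bsub>N\<^esub> = \<zero>\<^bsub>T\<^esub>"
  using pure_finsum_right[of "\<lambda>_. undefined" "{}" m] by simp

end

section \<open>Functoriality of the tensor product\<close>

locale tensor_mod_homs =
  source: tensor_modules A M N + target: tensor_modules A M' N'
  for A (structure) and M and N and M' and N' +
  fixes f g
  assumes f: "f \<in> mod_hom A M M'" and g: "g \<in> mod_hom A N N'"
begin

abbreviation "push \<equiv> frag_extend (\<lambda>p. frag_of (map_prod f g p))"

lemma push_closed:
  assumes "c \<in> carrier source.G"
  shows "push c \<in> carrier target.G"
proof -
  have "map_prod f g p \<in> carrier M' \<times> carrier N'" if "p \<in> Poly_Mapping.keys c" for p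
    using that assms mod_homD(1)[OF f] mod_homD(1)[OF g] by (cases p) auto
  then have "(\<Union>p\<in>Poly_Mapping.keys c. Poly_Mapping.keys (frag_of (map_prod f g p))) \<subseteq>
      carrier M' \<times> carrier N'"
    by auto
  then show ?thesis
    unfolding carrier_free_Abelian_group_iff by (rule order_trans[OF keys_frag_extend])
qed

text \<open>Sending \<open>(m, n)\<close> to the pure tensor of \<open>f m\<close> and
  \<open>g n\<close> is bilinear, so the composite of \<open>push\<close> with the quotient map
  kills the relations of the source.\<close>

lemma push_relations:
  assumes "c \<in> source.H"
  shows "target.cls (push c) = \<zero>\<^bsub>target.T\<^esub>"
proof (rule source.additive_vanishes_on_relations[OF target.abelian_group_tensor _ _ _ assms,
      where h = "\<lambda>c. target.cls (push c)" and \<beta> = "\<lambda>m n. target.pure (f m) (g n)"])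
  show "(\<lambda>c. target.cls (push c)) \<in> hom source.G (add_monoid target.T)"
  proof (rule homI)
    fix c d assume cd: "c \<in> carrier source.G" "d \<in> carrier source.G"
    show "target.cls (push c) \<in> carrier (add_monoid target.T)"
      using target.class_closed[OF push_closed[OF cd(1)]] by simp
    show "target.cls (push (c \<otimes>\<^bsub>source.G\<^esub> d)) =
        target.cls (push c) \<otimes>\<^bsub>add_monoid target.T\<^esub> target.cls (push d)"
      using target.class_add[OF push_closed[OF cd(1)] push_closed[OF cd(2)]]
      by (simp add: frag_extend_add)
  qed
  show "bilinear_map A M N target.T (\<lambda>m n. target.pure (f m) (g n))"
    using mod_homD[OF f] mod_homD[OF g]
    by (intro bilinear_mapI)
      (auto simp: target.pure_closed target.pure_add_left target.pure_add_right target.pure_smult)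
qed (simp add: pure_tensor_def)

text \<open>Connects the definition of \<open>tensor_map\<close> by cosets with computation on
  representatives. Another representative adds the push of a source relation, whose class is
  zero.\<close>

lemma tensor_map_class:
  assumes c: "c \<in> carrier source.G"
  shows "tensor_map A M' N' f g (source.cls c) = target.cls (push c)"
proof -
  have mem: "x \<in> target.cls d \<longleftrightarrow> (\<exists>h\<in>target.H. x = h + d)" for x d
    by (auto simp: tensor_class_def r_coset_def)
  have "tensor_map A M' N' f g (source.cls c) =
      {h' + push (h + c) | h' h. h' \<in> target.H \<and> h \<in> source.H}"
    by (auto simp: tensor_map_def set_mult_def tensor_class_def r_coset_def)
  also have "\<dots> = target.cls (push c)"
  proof (intro equalityI subsetI)
    fix x assume "x \<in> {h' + push (h + c) | h' h. h' \<in> target.H \<and> h \<in> source.H}"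
    then obtain h' h where x: "x = h' + push (h + c)" and h: "h' \<in> target.H" "h \<in> source.H"
      by blast
    have "h \<in> carrier source.G"
      by (rule source.relations_subset[OF h(2)])
    have "target.cls (push (h + c)) = target.cls (push h) \<oplus>\<^bsub>target.T\<^esub> target.cls (push c)"
      unfolding frag_extend_add using \<open>h \<in> carrier source.G\<close> c
      by (intro target.class_add push_closed)
    also have "\<dots> = target.cls (push c)"
      using push_relations[OF h(2)] target.class_closed[OF push_closed[OF c]] by simp
    finally show "x \<in> target.cls (push c)"
      using h(1) mem[of x "push (h + c)"] x by blast
  next
    fix x assume "x \<in> target.cls (push c)"
    \<comment> \<open>The representative \<open>c\<close> itself suffices, that is, the source
      relation \<open>0\<close>.\<close>
    then obtain h' where "h' \<in> target.H" "x = h' + push (0 + c)"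
      using mem by auto
    moreover have "0 \<in> source.H"
      using subgroup.one_closed[OF source.subgroup_relations] by simp
    ultimately show "x \<in> {h' + push (h + c) | h' h. h' \<in> target.H \<and> h \<in> source.H}"
      by blast
  qed
  finally show ?thesis .
qed

lemma tensor_map_pure:
  assumes "m \<in> carrier M" "n \<in> carrier N"
  shows "tensor_map A M' N' f g (source.pure m n) = target.pure (f m) (g n)"
  using tensor_map_class[of "frag_of (m, n)"] assms by (simp add: pure_tensor_def)

sublocale tensor_map: abelian_group_hom source.T target.T "tensor_map A M' N' f g"
proof (rule additive_imp_abelian_group_hom[OF source.abelian_group_tensor target.abelian_group_tensor])
  show "tensor_map A M' N' f g \<in> carrier source.T \<rightarrow> carrier target.T"
    unfolding source.carrier_tensor using push_closed
    by (auto simp: tensor_map_class target.class_closed simp del: carrier_free_Abelian_group_iff)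
  fix x y assume "x \<in> carrier source.T" "y \<in> carrier source.T"
  then obtain c d where c: "c \<in> carrier source.G" "x = source.cls c"
    and d: "d \<in> carrier source.G" "y = source.cls d"
    unfolding source.carrier_tensor by blast
  have cd: "c + d \<in> carrier source.G"
    using c(1) d(1) keys_add[of c d] by auto
  show "tensor_map A M' N' f g (x \<oplus>\<^bsub>source.T\<^esub> y) =
      tensor_map A M' N' f g x \<oplus>\<^bsub>target.T\<^esub> tensor_map A M' N' f g y"
    using source.class_add[OF c(1) d(1)] tensor_map_class[OF cd] tensor_map_class[OF c(1)]
      tensor_map_class[OF d(1)] target.class_add[OF push_closed[OF c(1)] push_closed[OF d(1)]]
    by (simp add: c(2) d(2) frag_extend_add)
qed

end

section \<open>Base change\<close>

locale base_change_module = A: cring A + B: cring B + M: module A M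
  for A :: "('a, 'p) ring_scheme" (structure) and B :: "('b, 'q) ring_scheme"
    and M :: "('a, 'm, 'x) module_scheme" +
  fixes \<phi> :: "'a \<Rightarrow> 'b"
  assumes hom: "\<phi> \<in> ring_hom A B"
begin

abbreviation "B' \<equiv> restrict_scalars \<phi> (ring_as_module B)"
abbreviation "MB \<equiv> base_change A B \<phi> M"

sublocale tensor_modules A M B'
  using M.module_axioms hom
  by (intro tensor_modules.intro module_restrict_scalars[OF A.is_cring _ module_ring_as_module]) (auto intro: B.is_cring)

lemma base_change_simps [simp]:
  "carrier MB = carrier T"
  "add MB = add T"
  "\<zero>\<^bsub>MB\<^esub> = \<zero>\<^bsub>T\<^esub>"
  by (simp_all add: base_change_def Let_def)

text \<open>Linearity over \<open>A\<close> allows the action of \<open>b\<close> on the second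
  factor to be treated as a \<open>tensor_map\<close>.\<close>

lemma mult_mod_hom:
  assumes "b \<in> carrier B"
  shows "(\<lambda>s. b \<otimes>\<^bsub>B\<^esub> s) \<in> mod_hom A B' B'"
  using assms ring_hom_memE(1)[OF hom] by (intro mod_homI) (auto simp: B.r_distr B.m_lcomm)

lemma tensor_mod_homs_mult:
  assumes "b \<in> carrier B"
  shows "tensor_mod_homs A M B' M B' id (\<lambda>s. b \<otimes>\<^bsub>B\<^esub> s)"
  using tensor_modules_axioms
  by (intro tensor_mod_homs.intro tensor_mod_homs_axioms.intro mult_mod_hom assms id_mod_hom)

lemma smult_pure:
  assumes "b \<in> carrier B" "m \<in> carrier M" "s \<in> carrier B"
  shows "b \<odot>\<^bsub>MB\<^esub> pure m s = pure m (b \<otimes>\<^bsub>B\<^esub> s)"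
  using tensor_mod_homs.tensor_map_pure[OF tensor_mod_homs_mult[OF assms(1)], of m s] assms(2,3)
  by (simp add: base_change_def Let_def)

lemma smult_hom:
  assumes "b \<in> carrier B"
  shows "abelian_group_hom T T (\<lambda>x. b \<odot>\<^bsub>MB\<^esub> x)"
proof -
  interpret tensor_mod_homs A M B' M B' id "\<lambda>s. b \<otimes>\<^bsub>B\<^esub> s"
    by (rule tensor_mod_homs_mult[OF assms])
  show ?thesis
    using tensor_map.abelian_group_hom_axioms by (simp add: base_change_def Let_def)
qed

text \<open>The existence half of the adjunction between extension and restriction of scalars. The
  universal property supplies an additive map; its linearity over \<open>B\<close> is then checked
  on pure tensors.\<close>

lemma extend_mod_hom:
  assumes f: "f \<in> mod_hom A M B'"
  obtains h where "h \<in> mod_hom B MB (ring_as_module B)"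
    and "\<And>m s. m \<in> carrier M \<Longrightarrow> s \<in> carrier B \<Longrightarrow> h (pure m s) = f m \<otimes>\<^bsub>B\<^esub> s"
proof -
  have fB: "f m \<in> carrier B" if "m \<in> carrier M" for m
    using mod_homD(1)[OF f that] by simp
  have "bilinear_map A M B' B (\<lambda>m s. f m \<otimes>\<^bsub>B\<^esub> s)"
    using mod_homD[OF f] ring_hom_memE(1)[OF hom]
    by (intro bilinear_mapI) (auto simp: B.l_distr B.r_distr B.m_ac)
  then obtain h where h: "abelian_group_hom T B h"
    "\<And>m s. m \<in> carrier M \<Longrightarrow> s \<in> carrier B \<Longrightarrow> h (pure m s) = f m \<otimes>\<^bsub>B\<^esub> s"
    by (rule tensor_universal[OF B.is_abelian_group]) auto
  interpret h: abelian_group_hom T B h by (rule h(1))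
  have "h \<in> mod_hom B MB (ring_as_module B)"
  proof (rule mod_homI)
    fix b x assume b: "b \<in> carrier B" and x: "x \<in> carrier MB"
    interpret smult: abelian_group_hom T T "\<lambda>x. b \<odot>\<^bsub>MB\<^esub> x"
      by (rule smult_hom[OF b])
    from x have "x \<in> carrier T" by simp
    then have "h (b \<odot>\<^bsub>MB\<^esub> x) = b \<otimes>\<^bsub>B\<^esub> h x"
    proof (induction x rule: tensor_induct)
      case (pure m s)
      then show ?case
        using b fB by (simp add: smult_pure h(2) B.m_lcomm)
    next
      case (diff x y)
      then show ?case
        using b by (simp add: smult.hom_minus h.hom_minus a_minus_def B.r_distr B.r_minus)
    qed (use b in simp)
    then show "h (b \<odot>\<^bsub>MB\<^esub> x) = b \<odot>\<^bsub>ring_as_module B\<^esub> h x"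
      by simp
  qed auto
  with h(2) show ?thesis
    by (rule that[rotated])
qed

lemma ideal_trace_base_change: "ideal (trace_ideal B MB) B"
proof (rule ideal_trace_ideal[OF B.is_cring])
  show "b \<odot>\<^bsub>MB\<^esub> x \<in> carrier MB" if "b \<in> carrier B" "x \<in> carrier MB" for b x
    using that abelian_group_hom.hom_closed[OF smult_hom] by simp
qed simp

lemma extended_trace_subset_trace_base_change:
  "extended_ideal B \<phi> (trace_ideal A M) \<subseteq> trace_ideal B MB"
proof (rule extended_trace_ideal_subsetI[OF A.is_cring B.is_cring hom ideal_trace_base_change])
  fix f x assume f: "f \<in> mod_hom A M (ring_as_module A)" and x: "x \<in> carrier M"
  note \<phi> = ring_hom_memE[OF hom]
  have "(\<lambda>m. \<phi> (f m)) \<in> mod_hom A M B'"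
    using mod_homD[OF f] by (intro mod_homI) (auto simp: \<phi>)
  then obtain h where h: "h \<in> mod_hom B MB (ring_as_module B)"
    "\<And>m s. m \<in> carrier M \<Longrightarrow> s \<in> carrier B \<Longrightarrow> h (pure m s) = \<phi> (f m) \<otimes>\<^bsub>B\<^esub> s"
    using extend_mod_hom by blast
  have "h (pure x \<one>\<^bsub>B\<^esub>) \<in> trace_ideal B MB"
    using x by (intro trace_ideal_memI[OF B.is_abelian_group h(1)]) (simp add: pure_closed)
  then show "\<phi> (f x) \<in> trace_ideal B MB"
    using x mod_homD(1)[OF f x] by (simp add: h(2) \<phi>)
qed

end

section \<open>Linear systems over noetherian rings\<close>

text \<open>Tuples of length \<open>n\<close> are represented by infinite sequences whose later
  entries are ignored, so that one type serves all lengths.\<close>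

definition dot :: "('a, 'p) ring_scheme \<Rightarrow> nat \<Rightarrow> (nat \<Rightarrow> 'a) \<Rightarrow> (nat \<Rightarrow> 'a) \<Rightarrow> 'a" where
  "dot A n v z = finsum A (\<lambda>j. v j \<otimes>\<^bsub>A\<^esub> z j) {..<n}"

text \<open>A submodule of the module of all sequences; negatives arise from the scalar
  \<open>\<ominus> \<one>\<close>.\<close>

definition sequence_submodule :: "('a, 'p) ring_scheme \<Rightarrow> (nat \<Rightarrow> 'a) set \<Rightarrow> bool" where
  "sequence_submodule A K \<longleftrightarrow>
     K \<subseteq> UNIV \<rightarrow> carrier A \<and> (\<lambda>_. \<zero>\<^bsub>A\<^esub>) \<in> K \<and>
     (\<forall>v\<in>K. \<forall>w\<in>K. (\<lambda>j. v j \<oplus>\<^bsub>A\<^esub> w j) \<in> K) \<and>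
     (\<forall>a\<in>carrier A. \<forall>v\<in>K. (\<lambda>j. a \<otimes>\<^bsub>A\<^esub> v j) \<in> K)"

context cring
begin

lemma dot_closed: "v \<in> UNIV \<rightarrow> carrier R \<Longrightarrow> z \<in> UNIV \<rightarrow> carrier R \<Longrightarrow> dot R n v z \<in> carrier R"
  unfolding dot_def by (intro finsum_closed) auto

lemma dot_Suc:
  assumes "v \<in> UNIV \<rightarrow> carrier R" "z \<in> UNIV \<rightarrow> carrier R"
  shows "dot R (Suc n) v z = v n \<otimes> z n \<oplus> dot R n v z"
  unfolding dot_def lessThan_Suc using assms by (subst finsum_insert) auto

lemma dot_commute:
  assumes "v \<in> UNIV \<rightarrow> carrier R" "z \<in> UNIV \<rightarrow> carrier R"
  shows "dot R n v z = dot R n z v"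
  unfolding dot_def using assms by (intro finsum_cong') (auto intro: m_comm)

lemma dot_add_left:
  assumes "v \<in> UNIV \<rightarrow> carrier R" "w \<in> UNIV \<rightarrow> carrier R" "z \<in> UNIV \<rightarrow> carrier R"
  shows "dot R n (\<lambda>j. v j \<oplus> w j) z = dot R n v z \<oplus> dot R n w z"
proof -
  have "dot R n (\<lambda>j. v j \<oplus> w j) z = (\<Oplus>j\<in>{..<n}. v j \<otimes> z j \<oplus> w j \<otimes> z j)"
    unfolding dot_def using assms by (intro finsum_cong') (auto simp: l_distr Pi_iff)
  also have "\<dots> = dot R n v z \<oplus> dot R n w z"
    unfolding dot_def using assms by (intro finsum_addf) (auto simp: Pi_iff)
  finally show ?thesis .
qed

lemma dot_smult_left:
  assumes "a \<in> carrier R" "v \<in> UNIV \<rightarrow> carrier R" "z \<in> UNIV \<rightarrow> carrier R"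
  shows "dot R n (\<lambda>j. a \<otimes> v j) z = a \<otimes> dot R n v z"
proof -
  have "dot R n (\<lambda>j. a \<otimes> v j) z = (\<Oplus>j\<in>{..<n}. a \<otimes> (v j \<otimes> z j))"
    unfolding dot_def using assms by (intro finsum_cong') (auto simp: m_assoc Pi_iff)
  also have "\<dots> = a \<otimes> dot R n v z"
    unfolding dot_def using assms by (intro finsum_rdistr[symmetric]) auto
  finally show ?thesis .
qed

lemma dot_zero_left:
  assumes "z \<in> UNIV \<rightarrow> carrier R"
  shows "dot R n (\<lambda>_. \<zero>) z = \<zero>"
  unfolding dot_def using assms by (intro add.finprod_one_eqI) (auto simp: Pi_iff)

lemma dot_unit_left:
  assumes "z \<in> UNIV \<rightarrow> carrier R" "j < n"
  shows "dot R n (\<lambda>i. if i = j then \<one> else \<zero>) z = z j"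
proof -
  have "dot R n (\<lambda>i. if i = j then \<one> else \<zero>) z = (\<Oplus>i\<in>{..<n}. if j = i then z i else \<zero>)"
    unfolding dot_def using assms(1) by (intro finsum_cong') (auto simp: Pi_iff)
  also have "\<dots> = z j"
    using assms by (intro finsum_singleton) auto
  finally show ?thesis .
qed

text \<open>The functional \<open>v \<mapsto> dot R n v z\<close> is linear, and its kernel inside
  \<open>K\<close> is again a submodule.\<close>

lemma sequence_submodule_orthogonal:
  assumes "sequence_submodule R K" "z \<in> UNIV \<rightarrow> carrier R"
  shows "sequence_submodule R {v \<in> K. dot R n v z = \<zero>}"
proof -
  have "v \<in> UNIV \<rightarrow> carrier R" if "v \<in> K" for v
    using assms(1) that by (auto simp: sequence_submodule_def)
  with assms show ?thesis
    unfolding sequence_submodule_def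
    by (auto simp: dot_add_left dot_smult_left dot_zero_left)
qed

lemma ideal_coordinates:
  assumes "sequence_submodule R K"
  shows "ideal ((\<lambda>v. v n) ` K) R"
proof -
  have K: "v \<in> UNIV \<rightarrow> carrier R" if "v \<in> K" for v
    using assms that by (auto simp: sequence_submodule_def)
  have mult: "a \<otimes> v n \<in> (\<lambda>v. v n) ` K" if "a \<in> carrier R" "v \<in> K" for a v
    using assms that unfolding sequence_submodule_def by (intro image_eqI[of _ _ "\<lambda>j. a \<otimes> v j"]) auto
  show ?thesis
  proof (rule idealI[OF ring_axioms])
    show "subgroup ((\<lambda>v. v n) ` K) (add_monoid R)"
    proof (rule add.subgroupI)
      show "(\<lambda>v. v n) ` K \<subseteq> carrier R" using K by auto
      show "(\<lambda>v. v n) ` K \<noteq> {}" using assms by (auto simp: sequence_submodule_def)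
    next
      fix a assume "a \<in> (\<lambda>v. v n) ` K"
      then obtain v where v: "v \<in> K" "a = v n" by auto
      then have "\<ominus> a = \<ominus> \<one> \<otimes> v n"
        using K[OF v(1)] by (auto simp: l_minus Pi_iff)
      with mult[of "\<ominus> \<one>" v] v show "\<ominus> a \<in> (\<lambda>v. v n) ` K" by simp
    next
      fix a b assume "a \<in> (\<lambda>v. v n) ` K" "b \<in> (\<lambda>v. v n) ` K"
      then obtain v w where "v \<in> K" "w \<in> K" "a = v n" "b = w n" by auto
      with assms show "a \<oplus> b \<in> (\<lambda>v. v n) ` K"
        unfolding sequence_submodule_def by (intro image_eqI[of _ _ "\<lambda>j. v j \<oplus> w j"]) auto
    qed
    show "a \<otimes> x \<in> (\<lambda>v. v n) ` K" if "a \<in> (\<lambda>v. v n) ` K" "x \<in> carrier R" for a x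
    proof -
      from that(1) obtain v where v: "v \<in> K" "a = v n" by auto
      with K[OF v(1)] that(2) have "a \<otimes> x = x \<otimes> v n"
        by (simp add: m_comm Pi_iff)
      with mult[OF that(2) v(1)] show ?thesis by simp
    qed
  qed (use mult in auto)
qed

text \<open>Splitting off the last coordinate: the last coordinates of \<open>K\<close> form a finitely generated ideal,
  and for fixed \<open>z\<close> those of the members of \<open>K\<close> orthogonal to \<open>z\<close> form an ideal as well. If it
  contains the generators, then every member of \<open>K\<close> is orthogonal to \<open>z\<close> up to a member whose last
  coordinate vanishes.\<close>

lemma finite_subsystem:
  assumes "noetherian_ring R" "sequence_submodule R K"
  shows "\<exists>S\<subseteq>K. finite S \<and> (\<forall>z\<in>UNIV \<rightarrow> carrier R.
           (\<forall>s\<in>S. dot R n s z = \<zero>) \<longrightarrow> (\<forall>v\<in>K. dot R n v z = \<zero>))"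
  using assms(2)
proof (induction n arbitrary: K)
  case 0
  show ?case
    by (intro exI[of _ "{}"]) (auto simp: dot_def)
next
  case (Suc n)
  \<comment> \<open>On \<open>?K'\<close> the last summand of a product of length
    \<open>Suc n\<close> vanishes, so the case \<open>n\<close> governs it.\<close>
  let ?K' = "{v \<in> K. v n = \<zero>}"
  have K: "v \<in> UNIV \<rightarrow> carrier R" if "v \<in> K" for v
    using Suc.prems that by (auto simp: sequence_submodule_def)
  have "sequence_submodule R ?K'"
    using Suc.prems by (auto simp: sequence_submodule_def)
  from Suc.IH[OF this] obtain S' where S': "S' \<subseteq> ?K'" "finite S'"
    "\<And>z. z \<in> UNIV \<rightarrow> carrier R \<Longrightarrow> \<forall>s\<in>S'. dot R n s z = \<zero> \<Longrightarrow> \<forall>v\<in>?K'. dot R n v z = \<zero>"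
    by blast
  obtain G where G: "G \<subseteq> carrier R" "finite G" "(\<lambda>v. v n) ` K = Idl G"
    using noetherian_ring.finetely_gen[OF assms(1) ideal_coordinates[OF Suc.prems, of n]] by blast
  then have "G \<subseteq> (\<lambda>v. v n) ` K"
    using genideal_self by simp
  \<comment> \<open>Generators of the ideal of last coordinates are lifted to finitely many members
    of \<open>K\<close>; together with \<open>S'\<close> they form the subsystem.\<close>
  then obtain U where U: "U \<subseteq> K" "finite U" "G = (\<lambda>v. v n) ` U"
    using finite_subset_image[OF G(2)] by metis
  have "dot R (Suc n) v z = \<zero>"
    if z: "z \<in> UNIV \<rightarrow> carrier R" and S: "\<forall>s\<in>S' \<union> U. dot R (Suc n) s z = \<zero>" and v: "v \<in> K" for z v
  proof -
    have "ideal ((\<lambda>v. v n) ` {v \<in> K. dot R (Suc n) v z = \<zero>}) R"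
      by (rule ideal_coordinates[OF sequence_submodule_orthogonal[OF Suc.prems z]])
    moreover have "G \<subseteq> (\<lambda>v. v n) ` {v \<in> K. dot R (Suc n) v z = \<zero>}"
      using U S by auto
    ultimately have "(\<lambda>v. v n) ` K \<subseteq> (\<lambda>v. v n) ` {v \<in> K. dot R (Suc n) v z = \<zero>}"
      unfolding G(3) by (rule genideal_minimal)
    with v obtain w where w: "w \<in> K" "dot R (Suc n) w z = \<zero>" "w n = v n"
      by (smt (verit) image_iff mem_Collect_eq subset_iff)
    \<comment> \<open>Since \<open>w\<close> has the same last coordinate as \<open>v\<close>, the
      difference falls into \<open>?K'\<close>. It is written with \<open>\<ominus> \<one>\<close>
      to fit the closure conditions of \<open>sequence_submodule\<close>.\<close>
    define u where "u = (\<lambda>j. v j \<oplus> \<ominus> \<one> \<otimes> w j)"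
    have uK: "u \<in> K"
      using Suc.prems v w(1) unfolding sequence_submodule_def u_def by simp
    have car: "v j \<in> carrier R" "w j \<in> carrier R" for j
      using K[OF v] K[OF w(1)] by auto
    have "u n = \<zero>"
      using w(3) car by (simp add: u_def l_minus r_neg)
    \<comment> \<open>Members of \<open>S'\<close> vanish at position \<open>n\<close>, so
      orthogonality for \<open>Suc n\<close> drops to \<open>n\<close>, the form required by the
      induction hypothesis.\<close>
    moreover have "\<forall>s\<in>S'. dot R n s z = \<zero>"
    proof
      fix s assume s: "s \<in> S'"
      then have "s \<in> UNIV \<rightarrow> carrier R" "s n = \<zero>" "dot R (Suc n) s z = \<zero>"
        using S'(1) K S by auto
      then show "dot R n s z = \<zero>"
        using dot_Suc[of s z n] z dot_closed[of s z n] by (auto simp: Pi_iff)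
    qed
    ultimately have "dot R (Suc n) u z = \<zero>"
      using S'(3)[OF z] uK dot_Suc[OF K[OF uK] z, of n] z by (auto simp: Pi_iff)
    moreover have "v = (\<lambda>j. u j \<oplus> w j)"
      using car by (auto simp: u_def l_minus a_assoc l_neg)
    ultimately show ?thesis
      using dot_add_left[OF K[OF uK] K[OF w(1)] z, of "Suc n"] w(2) by simp
  qed
  with S'(1,2) U(1,2) show ?case
    by (intro exI[of _ "S' \<union> U"]) auto
qed

end

section \<open>Linear systems over flat algebras\<close>

text \<open>Sequences are wrapped as singletons because \<open>flat_module\<close> only tests modules whose elements
  have type \<open>(nat \<Rightarrow> 'a) set\<close>.\<close>

definition sequence_module :: "('a, 'p) ring_scheme \<Rightarrow> ('a, (nat \<Rightarrow> 'a) set) module" where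
  "sequence_module A =
     \<lparr>carrier = (\<lambda>v. {v}) ` (UNIV \<rightarrow> carrier A), monoid.mult = undefined, one = undefined,
      ring.zero = {\<lambda>_. \<zero>\<^bsub>A\<^esub>}, add = (\<lambda>V W. {\<lambda>j. the_elem V j \<oplus>\<^bsub>A\<^esub> the_elem W j}),
      smult = (\<lambda>a V. {\<lambda>j. a \<otimes>\<^bsub>A\<^esub> the_elem V j})\<rparr>"

lemma sequence_module_simps [simp]:
  "V \<in> carrier (sequence_module A) \<longleftrightarrow> (\<exists>v\<in>UNIV \<rightarrow> carrier A. V = {v})"
  "\<zero>\<^bsub>sequence_module A\<^esub> = {\<lambda>_. \<zero>\<^bsub>A\<^esub>}"
  "{v} \<oplus>\<^bsub>sequence_module A\<^esub> {w} = {\<lambda>j. v j \<oplus>\<^bsub>A\<^esub> w j}"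
  "a \<odot>\<^bsub>sequence_module A\<^esub> {v} = {\<lambda>j. a \<otimes>\<^bsub>A\<^esub> v j}"
  by (auto simp: sequence_module_def)

lemma module_sequence_module:
  assumes "cring A"
  shows "module A (sequence_module A)"
proof -
  interpret cring A by fact
  have car: "v j \<in> carrier A" if "v \<in> UNIV \<rightarrow> carrier A" for v :: "nat \<Rightarrow> 'a" and j
    using that by auto
  have "abelian_group (sequence_module A)"
  proof (rule abelian_groupI)
    show "\<exists>W\<in>carrier (sequence_module A). W \<oplus>\<^bsub>sequence_module A\<^esub> V = \<zero>\<^bsub>sequence_module A\<^esub>"
      if "V \<in> carrier (sequence_module A)" for V
    proof -
      from that obtain v where "v \<in> UNIV \<rightarrow> carrier A" "V = {v}" by auto
      then show ?thesis
        by (intro bexI[of _ "{\<lambda>j. \<ominus>\<^bsub>A\<^esub> v j}"]) (auto simp: car l_neg)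
    qed
  qed (auto simp: car a_ac)
  then show ?thesis
    by (intro moduleI) (auto simp: assms car l_distr r_distr m_assoc)
qed

lemma (in cring) submodule_sequence_module:
  assumes "sequence_submodule R K"
  shows "submodule ((\<lambda>v. {v}) ` K) R (sequence_module R)"
proof -
  interpret P: module R "sequence_module R"
    by (rule module_sequence_module[OF is_cring])
  have K: "v \<in> UNIV \<rightarrow> carrier R" if "v \<in> K" for v
    using assms that by (auto simp: sequence_submodule_def)
  have smult: "a \<odot>\<^bsub>sequence_module R\<^esub> V \<in> (\<lambda>v. {v}) ` K"
    if "a \<in> carrier R" "V \<in> (\<lambda>v. {v}) ` K" for a V
    using that assms by (auto simp: sequence_submodule_def)
  have sub: "(\<lambda>v. {v}) ` K \<subseteq> carrier (sequence_module R)"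
    using K by auto
  show ?thesis
  proof (rule P.submoduleI)
    fix V assume V: "V \<in> (\<lambda>v. {v}) ` K"
    with sub have "V \<in> carrier (sequence_module R)"
      by blast
    then have "\<ominus>\<^bsub>sequence_module R\<^esub> V = (\<ominus> \<one>) \<odot>\<^bsub>sequence_module R\<^esub> V"
      by (simp add: P.smult_l_minus del: sequence_module_simps)
    then show "\<ominus>\<^bsub>sequence_module R\<^esub> V \<in> (\<lambda>v. {v}) ` K"
      using smult[OF _ V] by simp
  qed (use sub smult assms in \<open>auto simp: sequence_submodule_def\<close>)
qed

text \<open>With \<open>L\<close> the module of solutions over \<open>A\<close>, flatness is applied to the exact sequence of \<open>L\<close>,
  \<open>P\<close>, \<open>P\<close> given by the inclusion and the matrix \<open>k\<close>. The solution \<open>y\<close> over \<open>B\<close> is a kernel element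
  of \<open>P \<otimes> B\<close>, so it comes from \<open>L \<otimes> B\<close>; the \<open>j\<close>-th coordinate of a pure tensor there is
  \<open>\<phi> (z j) \<otimes> b\<close> for a solution \<open>z\<close>.\<close>

lemma flat_linear_system:
  fixes A :: "('a, 'p) ring_scheme" and B :: "('b, 'q) ring_scheme"
    and k :: "nat \<Rightarrow> nat \<Rightarrow> 'a" and y :: "nat \<Rightarrow> 'b"
  assumes "cring A" "cring B" and flat: "flat_ring_hom A B \<phi>"
    and k: "\<And>i. i < p \<Longrightarrow> k i \<in> UNIV \<rightarrow> carrier A"
    and y: "\<And>j. j < n \<Longrightarrow> y j \<in> carrier B"
    and eq: "\<And>i. i < p \<Longrightarrow> finsum B (\<lambda>j. \<phi> (k i j) \<otimes>\<^bsub>B\<^esub> y j) {..<n} = \<zero>\<^bsub>B\<^esub>"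
    and "j < n"
  shows "y j \<in> extended_ideal B \<phi>
    {z j | z. z \<in> UNIV \<rightarrow> carrier A \<and> (\<forall>i<p. dot A n (k i) z = \<zero>\<^bsub>A\<^esub>)}"
proof -
  interpret A: cring A by fact
  interpret B: cring B by fact
  define B' where "B' = restrict_scalars \<phi> (ring_as_module B)"
  have B'_simps: "carrier B' = carrier B" "add B' = add B" "\<zero>\<^bsub>B'\<^esub> = \<zero>\<^bsub>B\<^esub>"
    "\<And>a b. a \<odot>\<^bsub>B'\<^esub> b = \<phi> a \<otimes>\<^bsub>B\<^esub> b"
    by (simp_all add: B'_def)
  have hom: "\<phi> \<in> ring_hom A B" and flatB': "flat_module A B'"
    using flat by (simp_all add: flat_ring_hom_def B'_def)
  note \<phi> = ring_hom_memE[OF hom]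
  have modB': "module A B'"
    using flatB' by (simp add: flat_module_def)
  have finsum_B': "finsum B' = finsum B"
    by (rule finsum_cong_structure) (simp_all add: B'_simps)
  define Z where "Z = {z \<in> UNIV \<rightarrow> carrier A. \<forall>i<p. dot A n (k i) z = \<zero>\<^bsub>A\<^esub>}"
  define P where "P = sequence_module A"
  define L where "L = P\<lparr>carrier := (\<lambda>z. {z}) ` Z\<rparr>"
  \<comment> \<open>The matrix as an endomorphism of \<open>P\<close>: the \<open>p\<close> values
    are padded with zeros to an infinite sequence.\<close>
  define rows :: "(nat \<Rightarrow> 'a) set \<Rightarrow> (nat \<Rightarrow> 'a) set" where
    "rows V = {\<lambda>i. if i < p then dot A n (k i) (the_elem V) else \<zero>\<^bsub>A\<^esub>}" for V
  define unit :: "nat \<Rightarrow> (nat \<Rightarrow> 'a) set" where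
    "unit j = {\<lambda>i. if i = j then \<one>\<^bsub>A\<^esub> else \<zero>\<^bsub>A\<^esub>}" for j
  \<comment> \<open>The general facts on \<open>dot\<close> concern the left argument; symmetry
    moves them to the right, where the unknowns stand.\<close>
  have dot_add: "dot A n (k i) (\<lambda>j. v j \<oplus>\<^bsub>A\<^esub> w j) = dot A n (k i) v \<oplus>\<^bsub>A\<^esub> dot A n (k i) w"
    and dot_smult: "a \<in> carrier A \<Longrightarrow> dot A n (k i) (\<lambda>j. a \<otimes>\<^bsub>A\<^esub> v j) = a \<otimes>\<^bsub>A\<^esub> dot A n (k i) v"
    and dot_zero: "dot A n (k i) (\<lambda>_. \<zero>\<^bsub>A\<^esub>) = \<zero>\<^bsub>A\<^esub>"
    and dot_unit: "j < n \<Longrightarrow> dot A n (k i) (\<lambda>i. if i = j then \<one>\<^bsub>A\<^esub> else \<zero>\<^bsub>A\<^esub>) = k i j"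
    and dot_carrier: "dot A n (k i) v \<in> carrier A"
    if "i < p" "v \<in> UNIV \<rightarrow> carrier A" "w \<in> UNIV \<rightarrow> carrier A" for i v w a j
    using k[OF that(1)] that(2,3)
      A.dot_commute[of "k i" "\<lambda>j. v j \<oplus>\<^bsub>A\<^esub> w j" n] A.dot_commute[of "k i" v n] A.dot_commute[of "k i" w n]
      A.dot_commute[of "k i" "\<lambda>j. a \<otimes>\<^bsub>A\<^esub> v j" n] A.dot_commute[of "k i" "\<lambda>_. \<zero>\<^bsub>A\<^esub>" n]
      A.dot_commute[of "k i" "\<lambda>i. if i = j then \<one>\<^bsub>A\<^esub> else \<zero>\<^bsub>A\<^esub>" n]
    by (simp_all add: A.dot_add_left A.dot_smult_left A.dot_zero_left A.dot_unit_left A.dot_closed Pi_iff)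
  have zero_seq: "(\<lambda>_. \<zero>\<^bsub>A\<^esub>) \<in> UNIV \<rightarrow> carrier A"
    by simp
  have subZ: "sequence_submodule A Z"
    unfolding sequence_submodule_def Z_def
    using dot_add dot_smult dot_zero[OF _ zero_seq zero_seq] by (auto simp: Pi_iff)
  have modP: "module A P"
    unfolding P_def by (rule module_sequence_module) fact
  have modL: "module A L"
    unfolding L_def P_def
    by (rule submodule.submodule_is_module[OF A.submodule_sequence_module[OF subZ]
          module_sequence_module[OF \<open>cring A\<close>]])
  have rows_hom: "rows \<in> mod_hom A P P"
  proof (rule mod_homI)
    show "rows V \<in> carrier P" if "V \<in> carrier P" for V
      using that dot_carrier by (auto simp: P_def rows_def)
  qed (auto simp: P_def rows_def dot_add dot_smult fun_eq_iff)
  have incl: "id \<in> mod_hom A L P"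
    by (rule mod_homI) (auto simp: L_def P_def Z_def)
  \<comment> \<open>By construction \<open>Z\<close> consists of the sequences killed by
    \<open>rows\<close>.\<close>
  have exact: "exact_at L P P id rows"
    by (auto simp: exact_at_def a_kernel_def' L_def P_def Z_def rows_def fun_eq_iff split: if_splits)
  interpret TP: tensor_modules A P B'
    using modP modB' by (rule tensor_modules.intro)
  interpret TL: tensor_modules A L B'
    using modL modB' by (rule tensor_modules.intro)
  interpret rows: tensor_mod_homs A P B' P B' rows id
    by unfold_locales (auto intro: rows_hom id_mod_hom)
  interpret incl: tensor_mod_homs A L B' P B' id id
    by unfold_locales (auto intro: incl id_mod_hom)
  have exact_tensor: "exact_at TL.T TP.T TP.T (tensor_map A P B' id id) (tensor_map A P B' rows id)"
    using flatB' modP modL rows_hom incl exact unfolding flat_module_def by blast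

  have unit: "unit j \<in> carrier P" for j
    by (auto simp: unit_def P_def)
  \<comment> \<open>The tuple \<open>y\<close> as an element of the tensor product, with
    \<open>unit j\<close> in the role of the standard basis vectors.\<close>
  define x where "x = finsum TP.T (\<lambda>j. TP.pure (unit j) (y j)) {..<n}"
  have pure_y: "TP.pure V (y j) \<in> carrier TP.T" if "V \<in> carrier P" "j < n" for V j
    using that y by (simp add: TP.pure_closed B'_simps)
  have x_carrier: "x \<in> carrier TP.T"
    unfolding x_def using unit by (intro TP.T.finsum_closed) (auto simp: pure_y)
  \<comment> \<open>Column \<open>j\<close> of the matrix, cut off after its first \<open>q\<close>
    rows. The image of \<open>x\<close> is built up row by row, from the zero column at
    \<open>q = 0\<close> to the full one at \<open>q = p\<close>.\<close>
  define cut where "cut q j = {\<lambda>i. if i < q then k i j else \<zero>\<^bsub>A\<^esub>}" for q j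
  have cut: "cut q j \<in> carrier P" if "q \<le> p" for q j
    using that k by (auto simp: cut_def P_def Pi_iff)
  have cut_sum: "finsum TP.T (\<lambda>j. TP.pure (cut q j) (y j)) {..<n} = \<zero>\<^bsub>TP.T\<^esub>" if "q \<le> p" for q
    using that
  proof (induction q)
    case 0
    have "cut 0 j = \<zero>\<^bsub>P\<^esub>" for j
      by (simp add: cut_def P_def)
    then show ?case
      using y by (intro TP.T.add.finprod_one_eqI) (simp add: TP.pure_zero_left B'_simps)
  next
    case (Suc q)
    then have q: "q < p" "q \<le> p" by auto
    have kq: "k q j \<in> carrier A" for j
      using k[OF q(1)] by auto
    \<comment> \<open>The next row adds the entry \<open>k q j\<close> at position \<open>q\<close>;
      below, this scalar crosses the tensor sign as \<open>\<phi> (k q j)\<close>.\<close>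
    have split: "cut (Suc q) j = cut q j \<oplus>\<^bsub>P\<^esub> k q j \<odot>\<^bsub>P\<^esub> unit q" for j
      using k q by (auto simp: cut_def P_def unit_def fun_eq_iff Pi_iff less_Suc_eq)
    have "finsum TP.T (\<lambda>j. TP.pure (cut (Suc q) j) (y j)) {..<n} =
        finsum TP.T (\<lambda>j. TP.pure (cut q j) (y j) \<oplus>\<^bsub>TP.T\<^esub> TP.pure (unit q) (\<phi> (k q j) \<otimes>\<^bsub>B\<^esub> y j)) {..<n}"
    proof (rule TP.T.finsum_cong')
      fix j assume "j \<in> {..<n}"
      then have yj: "y j \<in> carrier B'"
        using y by (simp add: B'_simps)
      have "TP.pure (k q j \<odot>\<^bsub>P\<^esub> unit q) (y j) = TP.pure (unit q) (\<phi> (k q j) \<otimes>\<^bsub>B\<^esub> y j)"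
        using TP.pure_smult[OF kq unit yj] by (simp add: B'_simps)
      then show "TP.pure (cut (Suc q) j) (y j) =
          TP.pure (cut q j) (y j) \<oplus>\<^bsub>TP.T\<^esub> TP.pure (unit q) (\<phi> (k q j) \<otimes>\<^bsub>B\<^esub> y j)"
        unfolding split using TP.pure_add_left[OF cut[OF q(2)] TP.M.smult_closed[OF kq unit] yj]
        by simp
    qed (use cut[OF q(2)] unit kq y in
        \<open>auto intro!: TP.T.a_closed TP.pure_closed simp: B'_simps \<phi>\<close>)
    also have "\<dots> = finsum TP.T (\<lambda>j. TP.pure (cut q j) (y j)) {..<n} \<oplus>\<^bsub>TP.T\<^esub>
        finsum TP.T (\<lambda>j. TP.pure (unit q) (\<phi> (k q j) \<otimes>\<^bsub>B\<^esub> y j)) {..<n}"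
      using cut[OF q(2)] unit kq y
      by (intro TP.T.finsum_addf) (auto intro!: TP.pure_closed simp: B'_simps \<phi>)
    \<comment> \<open>Collecting row \<open>q\<close> in the second factor leaves the left side of
      equation \<open>q\<close>, which is zero.\<close>
    also have "finsum TP.T (\<lambda>j. TP.pure (unit q) (\<phi> (k q j) \<otimes>\<^bsub>B\<^esub> y j)) {..<n} =
        TP.pure (unit q) (finsum B' (\<lambda>j. \<phi> (k q j) \<otimes>\<^bsub>B\<^esub> y j) {..<n})"
      using unit kq y by (intro TP.pure_finsum_right[symmetric]) (auto simp: B'_simps \<phi>)
    also have "finsum B' (\<lambda>j. \<phi> (k q j) \<otimes>\<^bsub>B\<^esub> y j) {..<n} = \<zero>\<^bsub>B'\<^esub>"
      unfolding finsum_B' eq[OF q(1)] by (simp add: B'_simps)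
    finally show ?case
      using Suc.IH[OF q(2)] TP.pure_zero_right[OF unit] by simp
  qed
  have "tensor_map A P B' rows id x = finsum TP.T (\<lambda>j. TP.pure (cut p j) (y j)) {..<n}"
  proof -
    have "tensor_map A P B' rows id x =
        finsum TP.T (\<lambda>j. tensor_map A P B' rows id (TP.pure (unit j) (y j))) {..<n}"
      unfolding x_def using unit by (intro rows.tensor_map.hom_finsum) (auto simp: pure_y)
    also have "\<dots> = finsum TP.T (\<lambda>j. TP.pure (cut p j) (y j)) {..<n}"
    proof (rule TP.T.finsum_cong')
      fix j assume j: "j \<in> {..<n}"
      have "rows (unit j) = cut p j"
        using j dot_unit[OF _ zero_seq zero_seq] by (auto simp: rows_def unit_def cut_def fun_eq_iff)
      then show "tensor_map A P B' rows id (TP.pure (unit j) (y j)) = TP.pure (cut p j) (y j)"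
        using rows.tensor_map_pure[OF unit, of "y j" j] y j by (simp add: B'_simps)
    qed (use cut in \<open>auto simp: pure_y\<close>)
    finally show ?thesis .
  qed
  then have "tensor_map A P B' rows id x = \<zero>\<^bsub>TP.T\<^esub>"
    unfolding cut_sum[OF order_refl] .
  with x_carrier have "x \<in> a_kernel TP.T TP.T (tensor_map A P B' rows id)"
    unfolding a_kernel_def' by blast
  then obtain w where w: "w \<in> carrier TL.T" "x = tensor_map A P B' id id w"
    using exact_tensor unfolding exact_at_def by blast

  \<comment> \<open>The coordinate functional at \<open>j\<close>, extended to the tensor product;
    it takes \<open>x\<close> back to \<open>y j\<close>.\<close>
  have "bilinear_map A P B' B (\<lambda>V b. \<phi> (the_elem V j) \<otimes>\<^bsub>B\<^esub> b)"
    by (rule bilinear_mapI) (auto simp: P_def B'_simps \<phi> Pi_iff B.l_distr B.r_distr B.m_ac)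
  then obtain \<pi> where \<pi>: "abelian_group_hom TP.T B \<pi>"
    "\<And>V b. V \<in> carrier P \<Longrightarrow> b \<in> carrier B' \<Longrightarrow> \<pi> (TP.pure V b) = \<phi> (the_elem V j) \<otimes>\<^bsub>B\<^esub> b"
    by (rule TP.tensor_universal[OF B.is_abelian_group]) blast
  interpret \<pi>: abelian_group_hom TP.T B \<pi> by (rule \<pi>(1))
  have "\<pi> x = finsum B (\<lambda>i. \<pi> (TP.pure (unit i) (y i))) {..<n}"
    unfolding x_def using unit by (intro \<pi>.hom_finsum) (auto simp: pure_y)
  also have "\<dots> = finsum B (\<lambda>i. if j = i then y i else \<zero>\<^bsub>B\<^esub>) {..<n}"
    using y unit ring_hom_zero[OF hom A.ring_axioms B.ring_axioms]
    by (intro B.finsum_cong') (auto simp: \<pi>(2) B'_simps unit_def \<phi>)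
  also have "\<dots> = y j"
    using y \<open>j < n\<close> by (intro B.finsum_singleton) auto
  finally have \<pi>x: "\<pi> x = y j" .

  define I where "I = extended_ideal B \<phi> {z j | z. z \<in> Z}"
  have sub: "\<phi> ` {z j | z. z \<in> Z} \<subseteq> carrier B"
    by (auto simp: Z_def \<phi> Pi_iff)
  interpret I: ideal I B
    unfolding I_def extended_ideal_def using sub by (rule B.genideal_ideal)
  have "\<pi> (tensor_map A P B' id id w) \<in> I"
    using w(1)
  proof (induction w rule: TL.tensor_induct)
    case (pure V b)
    then obtain z where z: "z \<in> Z" "V = {z}"
      by (auto simp: L_def)
    have "V \<in> carrier P"
      using z by (auto simp: Z_def P_def)
    then have "\<pi> (tensor_map A P B' id id (TL.pure V b)) = \<phi> (z j) \<otimes>\<^bsub>B\<^esub> b"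
      using incl.tensor_map_pure[OF pure] pure(2) z(2) by (simp add: \<pi>(2))
    moreover have "\<phi> (z j) \<in> I"
      using z(1) B.genideal_self[OF sub] by (auto simp: I_def extended_ideal_def)
    ultimately show ?case
      using pure(2) I.I_r_closed by (simp only: B'_simps)
  next
    case (diff u v)
    have "\<pi> (tensor_map A P B' id id (u \<ominus>\<^bsub>TL.T\<^esub> v)) =
        \<pi> (tensor_map A P B' id id u) \<ominus>\<^bsub>B\<^esub> \<pi> (tensor_map A P B' id id v)"
      unfolding incl.tensor_map.hom_minus[OF diff(1,2)]
      by (intro \<pi>.hom_minus incl.tensor_map.hom_closed diff)
    then show ?case
      unfolding a_minus_def using diff(3,4) by (simp only: I.a_closed I.a_inv_closed)
  next
    case zero
    show ?case
      unfolding incl.tensor_map.hom_zero \<pi>.hom_zero by (rule I.zero_closed)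
  qed
  then show ?thesis
    using w(2) \<pi>x by (simp add: I_def Z_def conj_commute)
qed

section \<open>The reverse inclusion for flat base change\<close>

context base_change_module
begin

lemma trace_base_change_subset_extended_trace:
  assumes flat: "flat_ring_hom A B \<phi>" and noeth: "noetherian_ring A"
    and fg: "finitely_generated_module A M"
  shows "trace_ideal B MB \<subseteq> extended_ideal B \<phi> (trace_ideal A M)"
proof -
  note \<phi> = ring_hom_memE[OF hom]
  let ?V = "(UNIV :: nat set) \<rightarrow> carrier A"
  obtain S where S: "S \<subseteq> carrier M" "finite S"
    "carrier M = {finsum M (\<lambda>s. c s \<odot>\<^bsub>M\<^esub> s) S | c. c \<in> S \<rightarrow> carrier A}"
    using fg unfolding finitely_generated_module_def by blast
  \<comment> \<open>An injective enumeration of the generators turns sums over \<open>S\<close> into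
    sums over an initial segment, as in \<open>dot\<close>.\<close>
  obtain n \<mu> where \<mu>: "S = \<mu> ` {i::nat. i < n}" "inj_on \<mu> {i. i < n}"
    using finite_imp_nat_seg_image_inj_on[OF S(2)] by blast
  have S_eq: "S = \<mu> ` {..<n}" and inj: "inj_on \<mu> {..<n}"
    using \<mu> by (simp_all add: lessThan_def)
  have \<mu>M: "\<mu> j \<in> carrier M" if "j < n" for j
    using that S(1) S_eq by auto
  define comb where "comb v = finsum M (\<lambda>j. v j \<odot>\<^bsub>M\<^esub> \<mu> j) {..<n}" for v
  have comb_closed: "comb v \<in> carrier M" if "v \<in> ?V" for v
    unfolding comb_def using that \<mu>M by (intro M.M.finsum_closed) (auto simp: Pi_iff)
  have comb_surj: "\<exists>v\<in>?V. comb v = x" if x: "x \<in> carrier M" for x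
  proof -
    obtain c where c: "c \<in> S \<rightarrow> carrier A" "x = finsum M (\<lambda>s. c s \<odot>\<^bsub>M\<^esub> s) S"
      using x S(3) by auto
    \<comment> \<open>Entries from \<open>n\<close> on are set to zero to keep the whole sequence in
      the carrier.\<close>
    define v where "v j = (if j < n then c (\<mu> j) else \<zero>\<^bsub>A\<^esub>)" for j
    have "x = finsum M (\<lambda>j. c (\<mu> j) \<odot>\<^bsub>M\<^esub> \<mu> j) {..<n}"
      unfolding c(2) S_eq using inj c(1) \<mu>M S_eq
      by (intro M.M.finsum_reindex) (auto simp: Pi_iff)
    also have "\<dots> = comb v"
      unfolding comb_def using c(1) \<mu>M S_eq
      by (intro M.M.finsum_cong') (auto simp: v_def Pi_iff)
    finally show ?thesis
      using c(1) S_eq by (intro bexI[of _ v]) (auto simp: v_def Pi_iff)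
  qed
  have comb_add: "comb (\<lambda>j. v j \<oplus>\<^bsub>A\<^esub> w j) = comb v \<oplus>\<^bsub>M\<^esub> comb w" if "v \<in> ?V" "w \<in> ?V" for v w
  proof -
    have "comb (\<lambda>j. v j \<oplus>\<^bsub>A\<^esub> w j) =
        finsum M (\<lambda>j. v j \<odot>\<^bsub>M\<^esub> \<mu> j \<oplus>\<^bsub>M\<^esub> w j \<odot>\<^bsub>M\<^esub> \<mu> j) {..<n}"
      unfolding comb_def using that \<mu>M
      by (intro M.M.finsum_cong') (auto simp: M.smult_l_distr Pi_iff)
    also have "\<dots> = comb v \<oplus>\<^bsub>M\<^esub> comb w"
      unfolding comb_def using that \<mu>M by (intro M.M.finsum_addf) (auto simp: Pi_iff)
    finally show ?thesis .
  qed
  have comb_smult: "comb (\<lambda>j. a \<otimes>\<^bsub>A\<^esub> v j) = a \<odot>\<^bsub>M\<^esub> comb v" if "a \<in> carrier A" "v \<in> ?V" for a v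
  proof -
    have "comb (\<lambda>j. a \<otimes>\<^bsub>A\<^esub> v j) = finsum M (\<lambda>j. a \<odot>\<^bsub>M\<^esub> (v j \<odot>\<^bsub>M\<^esub> \<mu> j)) {..<n}"
      unfolding comb_def using that \<mu>M
      by (intro M.M.finsum_cong') (auto simp: M.smult_assoc1 Pi_iff)
    also have "\<dots> = a \<odot>\<^bsub>M\<^esub> comb v"
      unfolding comb_def using that \<mu>M
      by (intro M.finsum_smult_ldistr[symmetric]) (auto simp: Pi_iff)
    finally show ?thesis .
  qed
  have comb_zero: "comb (\<lambda>_. \<zero>\<^bsub>A\<^esub>) = \<zero>\<^bsub>M\<^esub>"
    unfolding comb_def using \<mu>M by (intro M.M.add.finprod_one_eqI) auto
  have comb_unit: "comb (\<lambda>i. if i = j then \<one>\<^bsub>A\<^esub> else \<zero>\<^bsub>A\<^esub>) = \<mu> j" if "j < n" for j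
  proof -
    have "comb (\<lambda>i. if i = j then \<one>\<^bsub>A\<^esub> else \<zero>\<^bsub>A\<^esub>) =
        finsum M (\<lambda>i. if j = i then \<mu> i else \<zero>\<^bsub>M\<^esub>) {..<n}"
      unfolding comb_def using \<mu>M by (intro M.M.finsum_cong') auto
    also have "\<dots> = \<mu> j"
      using that \<mu>M by (intro M.M.finsum_singleton) auto
    finally show ?thesis .
  qed

  \<comment> \<open>The relations among the generators. Noetherianity of \<open>A\<close> reduces
    orthogonality to all of them to orthogonality to a finite set \<open>S'\<close>.\<close>
  define K where "K = {v \<in> ?V. comb v = \<zero>\<^bsub>M\<^esub>}"
  have "sequence_submodule A K"
    unfolding sequence_submodule_def K_def
    by (auto simp: comb_add comb_smult comb_zero Pi_iff)
  from A.finite_subsystem[OF noeth this, of n] obtain S' where S': "S' \<subseteq> K" "finite S'"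
    "\<And>z v. z \<in> ?V \<Longrightarrow> \<forall>s\<in>S'. dot A n s z = \<zero>\<^bsub>A\<^esub> \<Longrightarrow> v \<in> K \<Longrightarrow> dot A n v z = \<zero>\<^bsub>A\<^esub>"
    by blast
  obtain p and k :: "nat \<Rightarrow> nat \<Rightarrow> 'a" where k: "S' = k ` {i. i < p}"
    using finite_imp_nat_seg_image_inj_on[OF S'(2)] by blast
  have kK: "k i \<in> K" if "i < p" for i
    using that S'(1) k by auto

  \<comment> \<open>A tuple prescribes a linear map on the generators exactly if it satisfies all their relations.\<close>
  have hom_of_solution: "\<exists>f\<in>mod_hom A M (ring_as_module A). \<forall>j<n. f (\<mu> j) = z j"
    if z: "z \<in> ?V" and sol: "\<forall>i<p. dot A n (k i) z = \<zero>\<^bsub>A\<^esub>" for z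
  proof -
    have K0: "dot A n v z = \<zero>\<^bsub>A\<^esub>" if "v \<in> K" for v
      using S'(3)[OF z _ that] sol k by auto
    \<comment> \<open>Two coefficient sequences of the same element differ by a relation, to which
      \<open>z\<close> is orthogonal.\<close>
    have wd: "dot A n v z = dot A n w z" if v: "v \<in> ?V" and w: "w \<in> ?V" and eq: "comb v = comb w" for v w
    proof -
      define d where "d = (\<lambda>j. v j \<ominus>\<^bsub>A\<^esub> w j)"
      have d: "d \<in> ?V"
        using v w by (auto simp: d_def Pi_iff)
      have v_eq: "v = (\<lambda>j. d j \<oplus>\<^bsub>A\<^esub> w j)"
        using v w by (auto simp: d_def a_minus_def A.a_assoc A.l_neg Pi_iff)
      have "comb w = comb d \<oplus>\<^bsub>M\<^esub> comb w"
        using comb_add[OF d w] eq v_eq by simp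
      then have "d \<in> K"
        using comb_closed[OF d] comb_closed[OF w] d by (simp add: K_def)
      then have "dot A n d z = \<zero>\<^bsub>A\<^esub>"
        by (rule K0)
      then show ?thesis
        using A.dot_add_left[OF d w z, of n] A.dot_closed[OF w z, of n] v_eq by simp
    qed
    \<comment> \<open>Evaluation through an arbitrarily chosen coefficient sequence; by
      \<open>wd\<close> the choice does not affect the value.\<close>
    define f where "f x = dot A n (SOME v. v \<in> ?V \<and> comb v = x) z" for x
    have f: "f (comb v) = dot A n v z" if "v \<in> ?V" for v
    proof -
      have "(SOME w. w \<in> ?V \<and> comb w = comb v) \<in> ?V \<and> comb (SOME w. w \<in> ?V \<and> comb w = comb v) = comb v"
        using that by (intro someI_ex[of "\<lambda>w. w \<in> ?V \<and> comb w = comb v"]) blast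
      then show ?thesis
        unfolding f_def using that by (intro wd) auto
    qed
    have "f \<in> mod_hom A M (ring_as_module A)"
    proof (rule mod_homI)
      fix x assume "x \<in> carrier M"
      then obtain v where v: "v \<in> ?V" "x = comb v"
        using comb_surj by blast
      then show "f x \<in> carrier (ring_as_module A)"
        using f A.dot_closed[OF v(1) z] by simp
      show "f (a \<odot>\<^bsub>M\<^esub> x) = a \<odot>\<^bsub>ring_as_module A\<^esub> f x" if a: "a \<in> carrier A" for a
      proof -
        have "(\<lambda>j. a \<otimes>\<^bsub>A\<^esub> v j) \<in> ?V"
          using a v(1) by (auto simp: Pi_iff)
        from f[OF this] show ?thesis
          using a v z by (simp add: comb_smult f A.dot_smult_left)
      qed
      fix y assume "y \<in> carrier M"
      then obtain w where w: "w \<in> ?V" "y = comb w"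
        using comb_surj by blast
      have "(\<lambda>j. v j \<oplus>\<^bsub>A\<^esub> w j) \<in> ?V"
        using w(1) v(1) by (auto simp: Pi_iff)
      from f[OF this] show "f (x \<oplus>\<^bsub>M\<^esub> y) = f x \<oplus>\<^bsub>ring_as_module A\<^esub> f y"
        using v w z by (simp add: comb_add f A.dot_add_left)
    qed
    moreover have "f (\<mu> j) = z j" if "j < n" for j
    proof -
      have "(\<lambda>i. if i = j then \<one>\<^bsub>A\<^esub> else \<zero>\<^bsub>A\<^esub>) \<in> ?V" by auto
      from f[OF this] show ?thesis
        using A.dot_unit_left[OF z that] comb_unit[OF that] by simp
    qed
    ultimately show ?thesis by blast
  qed

  let ?I = "extended_ideal B \<phi> (trace_ideal A M)"
  have tr_sub: "trace_ideal A M \<subseteq> carrier A"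
    by (rule trace_ideal_subsetI[OF A.oneideal]) (use mod_homD(1) in fastforce)
  have \<phi>tr_sub: "\<phi> ` trace_ideal A M \<subseteq> carrier B"
    using tr_sub \<phi>(1) by auto
  have ideal_I: "ideal ?I B"
    unfolding extended_ideal_def by (rule B.genideal_ideal[OF \<phi>tr_sub])
  interpret I: ideal ?I B by (rule ideal_I)
  show ?thesis
  proof (rule trace_ideal_subsetI[OF ideal_I])
    fix g t assume g: "g \<in> mod_hom B MB (ring_as_module B)" and t: "t \<in> carrier MB"
    interpret g: abelian_group_hom T B g
      using mod_homD[OF g]
      by (intro additive_imp_abelian_group_hom T.abelian_group_axioms B.is_abelian_group) auto
    \<comment> \<open>The restriction of \<open>g\<close> to tensors with one. It is linear over
      \<open>A\<close> via \<open>\<phi>\<close> and determines \<open>g\<close> on pure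
      tensors.\<close>
    define \<gamma> where "\<gamma> x = g (pure x \<one>\<^bsub>B\<^esub>)" for x
    interpret \<gamma>: abelian_group_hom M B \<gamma>
      by (intro additive_imp_abelian_group_hom M.M.abelian_group_axioms B.is_abelian_group)
        (auto simp: \<gamma>_def pure_closed pure_add_left)
    have g_pure: "g (pure x b) = b \<otimes>\<^bsub>B\<^esub> \<gamma> x" if "x \<in> carrier M" "b \<in> carrier B" for x b
      using mod_homD(3)[OF g, of b "pure x \<one>\<^bsub>B\<^esub>"] that
      by (simp add: \<gamma>_def smult_pure pure_closed)
    \<comment> \<open>The scalar crosses the tensor sign as \<open>\<phi> a\<close> and then comes
      out by linearity of \<open>g\<close> over \<open>B\<close>.\<close>
    have \<gamma>_smult: "\<gamma> (a \<odot>\<^bsub>M\<^esub> x) = \<phi> a \<otimes>\<^bsub>B\<^esub> \<gamma> x" if "a \<in> carrier A" "x \<in> carrier M" for a x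
      using that pure_smult[of a x "\<one>\<^bsub>B\<^esub>"] g_pure[of x "\<phi> a"] by (simp add: \<gamma>_def[of "a \<odot>\<^bsub>M\<^esub> x"] \<phi>)
    have \<gamma>_comb: "\<gamma> (comb v) = finsum B (\<lambda>j. \<phi> (v j) \<otimes>\<^bsub>B\<^esub> \<gamma> (\<mu> j)) {..<n}" if v: "v \<in> ?V" for v
    proof -
      have "\<gamma> (comb v) = finsum B (\<lambda>j. \<gamma> (v j \<odot>\<^bsub>M\<^esub> \<mu> j)) {..<n}"
        unfolding comb_def using v \<mu>M by (intro \<gamma>.hom_finsum) (auto simp: Pi_iff)
      also have "\<dots> = finsum B (\<lambda>j. \<phi> (v j) \<otimes>\<^bsub>B\<^esub> \<gamma> (\<mu> j)) {..<n}"
        using v \<mu>M by (intro B.finsum_cong') (auto simp: \<gamma>_smult \<phi> Pi_iff)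
      finally show ?thesis .
    qed
    have \<gamma>_gen: "\<gamma> (\<mu> j) \<in> ?I" if j: "j < n" for j
    proof -
      \<comment> \<open>Each \<open>k i\<close> is a relation, so applying \<open>\<gamma>\<close>
        to it gives one linear equation over \<open>B\<close> for the elements
        \<open>\<gamma> (\<mu> j)\<close>.\<close>
      have "\<gamma> (\<mu> j) \<in> extended_ideal B \<phi>
          {z j | z. z \<in> ?V \<and> (\<forall>i<p. dot A n (k i) z = \<zero>\<^bsub>A\<^esub>)}"
      proof (rule flat_linear_system[OF A.is_cring B.is_cring flat,
            where y = "\<lambda>j. \<gamma> (\<mu> j)" and j = j and n = n and k = k and p = p])
        show "k i \<in> ?V" if "i < p" for i
          using kK[OF that] by (simp add: K_def)
        show "\<gamma> (\<mu> j) \<in> carrier B" if "j < n" for j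
          using \<mu>M[OF that] by simp
        show "finsum B (\<lambda>j. \<phi> (k i j) \<otimes>\<^bsub>B\<^esub> \<gamma> (\<mu> j)) {..<n} = \<zero>\<^bsub>B\<^esub>" if "i < p" for i
          using kK[OF that] \<gamma>_comb[of "k i"] by (simp add: K_def)
      qed fact
      \<comment> \<open>The linear form attached to a solution \<open>z\<close> takes the value
        \<open>z j\<close> at \<open>\<mu> j\<close>, so \<open>z j\<close> lies in the
        trace.\<close>
      moreover have "{z j | z. z \<in> ?V \<and> (\<forall>i<p. dot A n (k i) z = \<zero>\<^bsub>A\<^esub>)} \<subseteq> trace_ideal A M"
      proof clarify
        fix z assume "z \<in> ?V" "\<forall>i<p. dot A n (k i) z = \<zero>\<^bsub>A\<^esub>"
        from hom_of_solution[OF this] obtain f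
          where f: "f \<in> mod_hom A M (ring_as_module A)" "\<forall>j<n. f (\<mu> j) = z j"
          by (rule bexE)
        have "f (\<mu> j) = z j"
          using f(2) j by blast
        then show "z j \<in> trace_ideal A M"
          using trace_ideal_memI[OF A.is_abelian_group f(1) \<mu>M[OF j]] by (simp only:)
      qed
      then have "extended_ideal B \<phi> {z j | z. z \<in> ?V \<and> (\<forall>i<p. dot A n (k i) z = \<zero>\<^bsub>A\<^esub>)} \<subseteq> ?I"
        unfolding extended_ideal_def by (intro B.subset_Idl_subset \<phi>tr_sub image_mono)
      ultimately show ?thesis by (rule rev_subsetD)
    qed
    \<comment> \<open>A general element is a combination of the generators, and the ideal absorbs
      the coefficients.\<close>
    have \<gamma>_I: "\<gamma> x \<in> ?I" if x: "x \<in> carrier M" for x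
    proof -
      obtain v where v: "v \<in> ?V" "x = comb v"
        using comb_surj[OF x] by blast
      show ?thesis
        unfolding v(2) \<gamma>_comb[OF v(1)] using v(1) \<gamma>_gen
        by (intro I.finsum_mem B.is_abelian_group) (auto intro!: I.I_l_closed simp: \<phi> Pi_iff)
    qed
    from t have "t \<in> carrier T" by simp
    then show "g t \<in> ?I"
    proof (induction t rule: tensor_induct)
      case (pure m b)
      then show ?case
        using I.I_l_closed \<gamma>_I by (simp add: g_pure)
    next
      case (diff s t)
      then show ?case
        by (simp add: g.hom_minus a_minus_def)
    qed simp
  qed
qed

end

theorem lemma1p5:
  fixes R1 :: "('a, 'p) ring_scheme" and R :: "('b, 'q) ring_scheme" and \<phi> :: "'a \<Rightarrow> 'b"
    and M :: "('b, 'm, 'x) module_scheme" and M1 :: "('a, 'n, 'y) module_scheme"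
  assumes "cring R1" and "cring R" and "\<phi> \<in> ring_hom R1 R"
    and "module R M" and "module R1 M1"
  shows "(\<phi> ` carrier R1 = carrier R \<longrightarrow>
           extended_ideal R \<phi> (trace_ideal R1 (restrict_scalars \<phi> M)) \<subseteq> trace_ideal R M) \<and>
         extended_ideal R \<phi> (trace_ideal R1 M1) \<subseteq> trace_ideal R (base_change R1 R \<phi> M1) \<and>
         (flat_ring_hom R1 R \<phi> \<and> noetherian_ring R1 \<and> finitely_generated_module R1 M1 \<longrightarrow>
           extended_ideal R \<phi> (trace_ideal R1 M1) = trace_ideal R (base_change R1 R \<phi> M1))"
proof -
  interpret base_change_module R1 R M1 \<phi>
    using assms(1-3,5) by (intro base_change_module.intro base_change_module_axioms.intro)
  show ?thesis
    using extended_trace_subset_trace_of_surj[OF assms(1,3,4)]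
      extended_trace_subset_trace_base_change trace_base_change_subset_extended_trace
    by blast
qed

end
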